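(* Let $I=(0,L)$ with $L>0$ and let $p\ge1$. For any $f\in L^\infty(I)$ that is not a.e. zero, has zero mean $\int_I f\,dx=0$, and has finite effective nodal set $Z(f)$, we have $$W_p(f_+,f_-)\cdot|Z(f)|\ \ge\ 2^{-1-\frac1p}\left(\frac{\|f\|_1}{\|f\|_\infty}\right)\|f\|_1^{\frac1p}.$$ This inequality is sharp: equality holds if and only if, with $c_\infty=\|f\|_\infty$, $c_1=\|f\|_1$, $N=|Z(f)|$, $f$ is a minimizer of $\min_{h\in X(c_\infty,c_1,N,I)}W_p(h_+,h_-)$, i.e. $f$ is a step function, anti-symmetric about each point of $Z(f)$, with value $\pm c_\infty$ and width $c_1/(2c_\infty N)$ (for each $z\in Z(f)$, $f$ equals $c_\infty$ on one of $(z-d,z)$, $(z,z+d)$ and $-c_\infty$ on the other, with $d=c_1/(2c_\infty N)$, and $f=0$ elsewhere).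
   Context: Effective nodal set. For a measurable $f:I\to\mathbb{R}$ with finite $L^1$ and $L^\infty$ norms, let $Z_1(f)=\partial\{x: f(x)>0\}\cap\partial\{x: f(x)<0\}$. Let $\mathcal{Z}(f)$ be the set of connected components of $f^{-1}(\{0\})$, and $\mathcal{Z}'(f)\subseteq\mathcal{Z}(f)$ the set of those components whose closure intersects both $\partial\{f>0\}$ and $\partial\{f<0\}$. Let $Z_2(f)$ be a set consisting of a unique point $x\in J$ for every $J\in\mathcal{Z}'(f)$. The effective nodal set is $Z(f)=Z_1(f)\cup Z_2(f)$. Admissible class. $X(c_\infty,c_1,N,I)$ is the set of measurable $f:I\to\mathbb{R}$ with $\|f\|_\infty=c_\infty$, $\|f\|_1=c_1$, $|Z(f)|=N$ and $\int_I f\,dx=0$. Transport. $f_\pm=\pm\max(\pm f,0)$, and $W_p(f_+,f_-)$ is the Wasserstein-$p$ distance between the two finite measures of equal mass with densities $f_+$ and $|f_-|$: $W_p(\mu_1,\mu_2)=\inf_{\gamma\in\Gamma(\mu_1,\mu_2)}\left(\int_{I\times I}|x-y|^p\,d\gamma(x,y)\right)^{1/p}$, where $\Gamma(\mu_1,\mu_2)$ is the set of Borel measures on $I\times I$ with marginals $\mu_1,\mu_2$ (no normalization to mass one). *)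

theory Defs
  imports "HOL-Analysis.Analysis" "HOL-Probability.Essential_Supremum"
begin

text \<open>
  A function on \<open>I\<close> is modelled by a total function \<open>real \<Rightarrow> real\<close>; every notion below only
  depends on its values on \<open>I\<close>. Measurability is Lebesgue measurability.
\<close>

definition Linf_enorm :: "real set \<Rightarrow> (real \<Rightarrow> real) \<Rightarrow> ereal" where
  "Linf_enorm I f = esssup (lebesgue_on I) (\<lambda>x. ereal \<bar>f x\<bar>)"

definition mem_Linf :: "real set \<Rightarrow> (real \<Rightarrow> real) \<Rightarrow> bool" where
  "mem_Linf I f \<longleftrightarrow> f \<in> borel_measurable (lebesgue_on I) \<and> Linf_enorm I f < \<infinity>"

definition Linf_norm :: "real set \<Rightarrow> (real \<Rightarrow> real) \<Rightarrow> real" where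
  "Linf_norm I f = real_of_ereal (Linf_enorm I f)"

definition L1_norm :: "real set \<Rightarrow> (real \<Rightarrow> real) \<Rightarrow> real" where
  "L1_norm I f = (\<integral>x. \<bar>f x\<bar> \<partial>lebesgue_on I)"

definition pos_set :: "real set \<Rightarrow> (real \<Rightarrow> real) \<Rightarrow> real set" where
  "pos_set I f = {x \<in> I. f x > 0}"

definition neg_set :: "real set \<Rightarrow> (real \<Rightarrow> real) \<Rightarrow> real set" where
  "neg_set I f = {x \<in> I. f x < 0}"

text \<open>Boundaries and closures are taken in the domain \<open>I\<close>.\<close>

definition nodal_crossings :: "real set \<Rightarrow> (real \<Rightarrow> real) \<Rightarrow> real set" where
  "nodal_crossings I f =
     (top_of_set I frontier_of pos_set I f) \<inter> (top_of_set I frontier_of neg_set I f)"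

definition zero_components :: "real set \<Rightarrow> (real \<Rightarrow> real) \<Rightarrow> real set set" where
  "zero_components I f = components {x \<in> I. f x = 0}"

definition effective_zero_components :: "real set \<Rightarrow> (real \<Rightarrow> real) \<Rightarrow> real set set" where
  "effective_zero_components I f =
     {J \<in> zero_components I f.
        (top_of_set I closure_of J) \<inter> (top_of_set I frontier_of pos_set I f) \<noteq> {} \<and>
        (top_of_set I closure_of J) \<inter> (top_of_set I frontier_of neg_set I f) \<noteq> {}}"

definition nodal_representatives :: "real set \<Rightarrow> (real \<Rightarrow> real) \<Rightarrow> real set \<Rightarrow> bool" where
  "nodal_representatives I f Z2 \<longleftrightarrow>
     Z2 \<subseteq> \<Union>(effective_zero_components I f) \<and>
     (\<forall>J\<in>effective_zero_components I f. \<exists>!x. x \<in> Z2 \<inter> J)"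

text \<open>
  The effective nodal set depends on the choice of the representatives \<open>Z2\<close>, so being an
  effective nodal set of \<open>f\<close> is a predicate. Finiteness does not depend on the choice, and
  neither does the number of elements when it is finite.
\<close>

definition effective_nodal_set :: "real set \<Rightarrow> (real \<Rightarrow> real) \<Rightarrow> real set \<Rightarrow> bool" where
  "effective_nodal_set I f Z \<longleftrightarrow>
     (\<exists>Z2. nodal_representatives I f Z2 \<and> Z = nodal_crossings I f \<union> Z2)"

definition admissible :: "real \<Rightarrow> real \<Rightarrow> nat \<Rightarrow> real set \<Rightarrow> (real \<Rightarrow> real) set" where
  "admissible c_inf c_1 N I =
     {f. mem_Linf I f \<and> Linf_norm I f = c_inf \<and> L1_norm I f = c_1 \<and>
         (\<exists>Z. effective_nodal_set I f Z \<and> finite Z \<and> card Z = N) \<and>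
         (\<integral>x. f x \<partial>lebesgue_on I) = 0}"

definition f_plus :: "(real \<Rightarrow> real) \<Rightarrow> real \<Rightarrow> real" where
  "f_plus f x = max (f x) 0"

definition f_minus :: "(real \<Rightarrow> real) \<Rightarrow> real \<Rightarrow> real" where
  "f_minus f x = - max (- f x) 0"

text \<open>
  The measure with density \<open>\<bar>g\<bar>\<close>, as a Borel measure on \<open>I\<close>: since \<open>g\<close> is only Lebesgue
  measurable, the measure is built on the Lebesgue sets and then restricted to the Borel sets.
\<close>

definition mass_measure :: "real set \<Rightarrow> (real \<Rightarrow> real) \<Rightarrow> real measure" where
  "mass_measure I g =
     distr (density (lebesgue_on I) (\<lambda>x. ennreal \<bar>g x\<bar>)) (restrict_space borel I) (\<lambda>x. x)"

definition couplings :: "'a measure \<Rightarrow> 'b measure \<Rightarrow> ('a \<times> 'b) measure set" where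
  "couplings M N =
     {\<gamma>. sets \<gamma> = sets (M \<Otimes>\<^sub>M N) \<and> distr \<gamma> M fst = M \<and> distr \<gamma> N snd = N}"

text \<open>
  Real-valued. It is used for finite measures of equal mass on a bounded interval, where
  couplings exist and every cost is finite.
\<close>

definition wasserstein :: "real \<Rightarrow> real measure \<Rightarrow> real measure \<Rightarrow> real" where
  "wasserstein p M N =
     (INF \<gamma>\<in>couplings M N. (\<integral>(x, y). \<bar>x - y\<bar> powr p \<partial>\<gamma>) powr (1 / p))"

definition W_parts :: "real \<Rightarrow> real set \<Rightarrow> (real \<Rightarrow> real) \<Rightarrow> real" where
  "W_parts p I f = wasserstein p (mass_measure I (f_plus f)) (mass_measure I (f_minus f))"

text \<open>
  Values are prescribed almost everywhere: changing \<open>f\<close> on a null set can leave its norms, its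
  transport cost and its effective nodal set unchanged. The anti-symmetry about \<open>z\<close> is the one
  on \<open>(z - d, z + d)\<close>.
\<close>

definition antisymmetric_step ::
    "real set \<Rightarrow> real set \<Rightarrow> real \<Rightarrow> real \<Rightarrow> (real \<Rightarrow> real) \<Rightarrow> bool" where
  "antisymmetric_step I Z c d f \<longleftrightarrow>
     (\<forall>z\<in>Z. {z - d<..<z + d} \<subseteq> I \<and>
        ((AE x in lebesgue_on {z - d<..<z}. f x = c) \<and>
           (AE x in lebesgue_on {z<..<z + d}. f x = - c) \<or>
         (AE x in lebesgue_on {z - d<..<z}. f x = - c) \<and>
           (AE x in lebesgue_on {z<..<z + d}. f x = c))) \<and>
     (AE x in lebesgue_on (I - (\<Union>z\<in>Z. {z - d<..<z + d})). f x = 0)"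

end

theory Submission
  imports Defs
begin

text \<open>
  Let \<open>d = \<parallel>f\<parallel>\<^sub>1 / (2 \<parallel>f\<parallel>\<^sub>\<infinity> N)\<close> with \<open>N = |Z|\<close>. The claim is that
  \<open>W\<^sub>p \<ge> d (\<parallel>f\<parallel>\<^sub>1 / 2)\<^sup>1\<^sup>/\<^sup>p\<close>: in the \<open>p\<close>-th mean, the mass
  \<open>\<parallel>f\<parallel>\<^sub>1 / 2\<close> travels at least as far as \<open>d\<close>.

  Between a point where \<open>f > 0\<close> and a point where \<open>f < 0\<close> there is a point of \<open>Z\<close>, so with \<open>\<delta> = dist(\<cdot>, Z)\<close> any coupling \<open>\<gamma>\<close> of
  \<open>f\<^sub>+\<close> and \<open>|f\<^sub>-|\<close> is concentrated on pairs with \<open>|x - y| \<ge> \<delta> x + \<delta> y\<close>. The right-hand side sees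
  only the marginals, and \<open>\<integral> (\<delta> x + \<delta> y) d\<gamma> = \<integral> \<delta> |f|\<close> for every \<open>\<gamma>\<close>. For \<open>p > 1\<close> one bounds \<open>t\<^sup>p\<close>
  from below by its tangent at \<open>t = d\<close>; nothing is lost, because in the extremal
  configuration all mass moves by exactly \<open>d\<close> (\<open>transport_cost_ge\<close>). Finally
  \<open>\<integral> \<delta> |f|\<close> is smallest when \<open>|f|\<close> has its maximal value on the \<open>d\<close>-neighbourhood of \<open>Z\<close>
  and vanishes elsewhere (\<open>bathtub\<close>).

  Equality forces this form of \<open>|f|\<close>, and then the total mass forces the \<open>d\<close>-balls
  around the points of \<open>Z\<close> to be disjoint and to lie in \<open>I\<close>. The sign of \<open>f\<close> is constant on each half
  of a ball, since no point of \<open>Z\<close> lies in it. If both halves of the ball around \<open>z\<close> had the same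
  sign, then \<open>Z - {z}\<close> would still separate the signs up to a null set, and the bound for
  \<open>N - 1\<close> points would exceed the cost (\<open>antisymmetric_step_of_equality\<close>). This is why the lower
  bound is proved for every finite set that separates the signs almost everywhere, and not
  only for effective nodal sets.

  Conversely, for an antisymmetric step function the translation by \<open>d\<close> between the two halves of
  each ball is a coupling in which every distance equals \<open>d\<close> (\<open>W_parts_antisymmetric_step\<close>). A
  square wave with \<open>N\<close> jumps shows that the bound is attained in the admissible class, so that
  equality, minimality and the shape of an antisymmetric step function are equivalent.
\<close>

section \<open>Sign changes and separating sets\<close>

text \<open>
  The null set makes the notion insensitive to changes of \<open>f\<close> on null sets. This matters for the
  case of equality: an effective nodal set can contain a point that is a sign change only because
  of the value of \<open>f\<close> at that single point, and such a point has to be removable.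
\<close>

definition separates :: "real set \<Rightarrow> real set \<Rightarrow> (real \<Rightarrow> real) \<Rightarrow> bool" where
  "separates I Z f \<longleftrightarrow>
     (\<exists>E. negligible E \<and>
        (\<forall>x\<in>I - E. \<forall>y\<in>I - E. f x > 0 \<longrightarrow> f y < 0 \<longrightarrow> (\<exists>z\<in>Z. z \<in> closed_segment x y)))"

lemma frontier_of_top_of_set:
  assumes "S \<subseteq> I"
  shows "x \<in> top_of_set I frontier_of S \<longleftrightarrow> x \<in> I \<and> x \<in> closure S \<and> x \<in> closure (I - S)"
  using assms by (auto simp: frontier_of_closures closure_of_subtopology Int_absorb1 Int_Diff)

lemma closure_of_top_of_set:
  assumes "S \<subseteq> I"
  shows "top_of_set I closure_of S = I \<inter> closure S"
  using assms by (simp add: closure_of_subtopology Int_absorb1)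

text \<open>
  Let \<open>a\<close> be the first point of \<open>closure V\<close> after \<open>x\<close>, and \<open>b\<close> the last point of \<open>closure U\<close> before
  \<open>a\<close>. If \<open>a = b\<close>, the two sets touch there; otherwise \<open>(b, a)\<close> is a gap between them. For the sets
  where \<open>f\<close> is positive and negative, the first case yields a point of \<open>nodal_crossings\<close>, the second
  an effective zero component.
\<close>

lemma crossing_or_gap:
  fixes U V I :: "real set"
  assumes I: "is_interval I" and UV: "U \<subseteq> I" "V \<subseteq> I" "U \<inter> V = {}"
    and x: "x \<in> U" and y: "y \<in> V" and "x < y"
  obtains (crossing) a where "a \<in> {x..y}"
      "a \<in> top_of_set I frontier_of U" "a \<in> top_of_set I frontier_of V"
  | (gap) b a where "x \<le> b" "b < a" "a \<le> y" "{b<..<a} \<inter> (U \<union> V) = {}"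
      "b \<in> top_of_set I frontier_of U" "a \<in> top_of_set I frontier_of V"
proof -
  have mem_I: "t \<in> I" if "t \<in> {x..y}" for t
    using that x y UV I by (meson atLeastAtMost_iff mem_is_interval_1_I subsetD)
  define a where "a = Inf (V \<inter> {x..y})"
  have yV: "y \<in> V \<inter> {x..y}" using y \<open>x < y\<close> by auto
  have bddV: "bdd_below (V \<inter> {x..y})" by auto
  have a_cl: "a \<in> closure (V \<inter> {x..y})"
    unfolding a_def using yV bddV by (intro closure_contains_Inf) auto
  have axy: "a \<in> {x..y}"
    using a_cl closure_mono[of "V \<inter> {x..y}" "{x..y}"] by auto
  have a_clV: "a \<in> closure V" using a_cl closure_mono[of "V \<inter> {x..y}" V] by auto
  have noV: "t \<notin> V" if "x \<le> t" "t < a" for t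
    using cInf_lower[OF _ bddV, of t] that axy unfolding a_def by fastforce
  define b where "b = Sup (U \<inter> {x..a})"
  have xU: "x \<in> U \<inter> {x..a}" using x axy by auto
  have bddU: "bdd_above (U \<inter> {x..a})" by auto
  have b_cl: "b \<in> closure (U \<inter> {x..a})"
    unfolding b_def using xU bddU by (intro closure_contains_Sup) auto
  have bxa: "b \<in> {x..a}"
    using b_cl closure_mono[of "U \<inter> {x..a}" "{x..a}"] by auto
  have b_clU: "b \<in> closure U" using b_cl closure_mono[of "U \<inter> {x..a}" U] by auto
  have noU: "t \<notin> U" if "b < t" "t \<le> a" for t
    using cSup_upper[OF _ bddU, of t] that bxa unfolding b_def by fastforce
  show ?thesis
  proof (cases "b = a")
    case True
    have "a \<in> closure (I - U)" using a_clV closure_mono[of V "I - U"] UV by blast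
    moreover have "a \<in> closure (I - V)"
      using b_clU True closure_mono[of U "I - V"] UV by blast
    ultimately show ?thesis
      using crossing[of a] axy a_clV b_clU True UV mem_I by (simp add: frontier_of_top_of_set)
  next
    case False
    then have "b < a" using bxa by auto
    have gap_free: "{b<..<a} \<inter> (U \<union> V) = {}" using noU noV bxa by fastforce
    have "{b<..<a} \<subseteq> I" using mem_I axy bxa by auto
    then have sub: "{b..a} \<subseteq> closure (I - U)" "{b..a} \<subseteq> closure (I - V)"
      using closure_mono[of "{b<..<a}" "I - U"] closure_mono[of "{b<..<a}" "I - V"]
        gap_free \<open>b < a\<close> by (auto simp: closure_greaterThanLessThan)
    have "b \<in> top_of_set I frontier_of U" "a \<in> top_of_set I frontier_of V"
      using b_clU a_clV sub UV mem_I axy bxa \<open>b < a\<close>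
      by (auto simp: frontier_of_top_of_set intro!: subsetD[OF sub(1)] subsetD[OF sub(2)])
    then show ?thesis using gap[of b a] bxa axy \<open>b < a\<close> gap_free by auto
  qed
qed

lemma zero_gap_component:
  fixes f :: "real \<Rightarrow> real" and b a :: real
  assumes ba: "b < a" and zero: "\<And>t. t \<in> {b<..<a} \<Longrightarrow> t \<in> I \<and> f t = 0"
  obtains J where "J \<in> zero_components I f" "{b<..<a} \<subseteq> J"
proof -
  let ?S = "{x \<in> I. f x = 0}"
  let ?J = "connected_component_set ?S ((a + b) / 2)"
  have mid: "(a + b) / 2 \<in> {b<..<a}" using ba by auto
  then have "?J \<in> zero_components I f"
    unfolding zero_components_def using zero by (auto simp: components_def)
  moreover have "{b<..<a} \<subseteq> ?J"
    using mid zero by (intro connected_component_maximal) auto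
  ultimately show ?thesis using that by blast
qed

text \<open>
  The property of effective nodal sets from which the lower bound follows.
\<close>

lemma effective_nodal_set_meets:
  assumes I: "is_interval I" and Z: "effective_nodal_set I f Z"
    and xy: "x \<in> I" "y \<in> I" "x < y" and sgn: "f x * f y < 0"
  shows "\<exists>z\<in>Z. z \<in> {x..y}"
proof -
  obtain Z2 where Z2: "nodal_representatives I f Z2" and Zeq: "Z = nodal_crossings I f \<union> Z2"
    using Z by (auto simp: effective_nodal_set_def)
  obtain U V where UV: "x \<in> U" "y \<in> V" "{U, V} = {pos_set I f, neg_set I f}"
  proof (cases "f x > 0")
    case True
    then have "x \<in> pos_set I f" "y \<in> neg_set I f"
      using xy sgn by (auto simp: pos_set_def neg_set_def mult_less_0_iff)
    then show ?thesis by (rule that) simp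
  next
    case False
    then have "x \<in> neg_set I f" "y \<in> pos_set I f"
      using xy sgn by (auto simp: pos_set_def neg_set_def mult_less_0_iff)
    then show ?thesis by (rule that) auto
  qed
  then have sub: "U \<subseteq> I" "V \<subseteq> I" "U \<inter> V = {}" and nz: "\<And>t. t \<in> I \<Longrightarrow> t \<notin> U \<union> V \<Longrightarrow> f t = 0"
    by (auto simp: doubleton_eq_iff pos_set_def neg_set_def)
  have U0: "f t \<noteq> 0" if "t \<in> U \<union> V" for t
    using that UV(3) by (auto simp: doubleton_eq_iff pos_set_def neg_set_def)
  from I sub UV(1,2) xy(3) show ?thesis
  proof (cases rule: crossing_or_gap)
    case (crossing a)
    then have "a \<in> nodal_crossings I f"
      using UV(3) by (auto simp: nodal_crossings_def doubleton_eq_iff)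
    then show ?thesis using crossing Zeq by auto
  next
    case (gap b a)
    have zero: "t \<in> I \<and> f t = 0" if "t \<in> {b<..<a}" for t
    proof -
      have "t \<in> I" using that gap xy I
        by (meson greaterThanLessThan_iff less_imp_le mem_is_interval_1_I order_trans)
      moreover have "t \<notin> U \<union> V" using gap(4) that by blast
      ultimately show ?thesis using nz by blast
    qed
    obtain J where J: "J \<in> zero_components I f" and baJ: "{b<..<a} \<subseteq> J"
      using zero_gap_component[OF gap(2) zero] by blast
    have JI: "J \<subseteq> {x \<in> I. f x = 0}" and conJ: "connected J"
      using J in_components_subset in_components_connected unfolding zero_components_def by blast+
    have "{b..a} \<subseteq> closure J"
      using closure_mono[OF baJ] gap(2) by (simp add: closure_greaterThanLessThan)
    moreover have "a \<in> I" "b \<in> I"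
      using gap sub by (auto simp: frontier_of_top_of_set)
    moreover have "J \<subseteq> I" using JI by blast
    ultimately have "b \<in> top_of_set I closure_of J" "a \<in> top_of_set I closure_of J"
      using gap(2) by (auto simp: closure_of_top_of_set)
    then have "J \<in> effective_zero_components I f"
      using J gap UV(3) unfolding effective_zero_components_def by (auto simp: doubleton_eq_iff)
    then obtain z where z: "z \<in> Z2" "z \<in> J"
      using Z2 unfolding nodal_representatives_def by blast
    \<comment> \<open>The representative may lie anywhere in \<open>J\<close>, but \<open>J\<close> is connected and contains
      neither \<open>x\<close> nor \<open>y\<close>, so it is trapped between them.\<close>
    have "x \<notin> J" "y \<notin> J" using JI U0 UV by auto
    obtain m where m: "m \<in> {b<..<a}" using gap(2) dense by auto
    then have "m \<in> J" "x < m" "m < y" using baJ gap by auto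
    have "x \<le> z" using connectedD_interval[OF conJ z(2) \<open>m \<in> J\<close>, of x] \<open>x \<notin> J\<close> \<open>x < m\<close> by linarith
    moreover have "z \<le> y"
      using connectedD_interval[OF conJ \<open>m \<in> J\<close> z(2), of y] \<open>y \<notin> J\<close> \<open>m < y\<close> by linarith
    ultimately show ?thesis using z Zeq by auto
  qed
qed

lemma effective_nodal_set_separates:
  assumes "is_interval I" "effective_nodal_set I f Z"
  shows "separates I Z f"
  unfolding separates_def
proof (intro exI conjI ballI impI)
  show "negligible ({} :: real set)" by simp
  fix x y assume xy: "x \<in> I - {}" "y \<in> I - {}" and f: "f x > 0" "f y < 0"
  then have "x \<noteq> y" by auto
  then show "\<exists>z\<in>Z. z \<in> closed_segment x y"
    using effective_nodal_set_meets[OF assms, of x y] effective_nodal_set_meets[OF assms, of y x] xy f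
    by (cases "x < y") (auto simp: closed_segment_eq_real_ivl mult_less_0_iff)
qed

section \<open>The measure with a given density\<close>

lemma id_measurable_mass_measure:
  fixes I :: "real set"
  shows "(\<lambda>x. x) \<in> density (lebesgue_on I) h \<rightarrow>\<^sub>M restrict_space borel I"
proof -
  have "(\<lambda>x. x) \<in> lebesgue_on I \<rightarrow>\<^sub>M restrict_space borel I"
    by (rule measurable_restrict_space3) (auto simp: measurable_completion)
  then show ?thesis by simp
qed

lemma space_mass_measure [simp]: "space (mass_measure I g) = I"
  by (simp add: mass_measure_def space_restrict_space)

lemma sets_mass_measure [simp, measurable_cong]:
  "sets (mass_measure I g) = sets (restrict_space borel I)"
  by (simp add: mass_measure_def)

lemma emeasure_mass_measure:
  assumes I: "I \<in> sets lebesgue" and g: "g \<in> borel_measurable (lebesgue_on I)"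
    and A: "A \<in> sets (restrict_space borel I)"
  shows "emeasure (mass_measure I g) A = (\<integral>\<^sup>+x. ennreal \<bar>g x\<bar> * indicator A x \<partial>lebesgue_on I)"
proof -
  have A': "A \<in> sets (lebesgue_on I)" and "A \<subseteq> I"
  proof -
    obtain B where "B \<in> sets borel" "A = I \<inter> B"
      using A unfolding sets_restrict_space by blast
    then show "A \<in> sets (lebesgue_on I)" "A \<subseteq> I"
      by (simp_all add: sets_restrict_space)
  qed
  have "emeasure (mass_measure I g) A = emeasure (density (lebesgue_on I) (\<lambda>x. ennreal \<bar>g x\<bar>)) A"
    unfolding mass_measure_def using \<open>A \<subseteq> I\<close>
    by (subst emeasure_distr[OF id_measurable_mass_measure A]) (simp add: Int_absorb2)
  also have "\<dots> = (\<integral>\<^sup>+x. ennreal \<bar>g x\<bar> * indicator A x \<partial>lebesgue_on I)"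
    using A' g by (intro emeasure_density) auto
  finally show ?thesis .
qed

lemma integral_mass_measure:
  fixes h :: "real \<Rightarrow> real"
  assumes g: "g \<in> borel_measurable (lebesgue_on I)" and h: "h \<in> borel_measurable borel"
  shows "(\<integral>x. h x \<partial>mass_measure I g) = (\<integral>x. h x * \<bar>g x\<bar> \<partial>lebesgue_on I)"
proof -
  have h': "h \<in> borel_measurable (lebesgue_on I)"
    using h by (intro measurable_restrict_space1 measurable_completion) simp
  have "(\<integral>x. h x \<partial>mass_measure I g) = (\<integral>x. h x \<partial>density (lebesgue_on I) (\<lambda>x. ennreal \<bar>g x\<bar>))"
    unfolding mass_measure_def
    by (rule integral_distr[OF id_measurable_mass_measure]) (use h measurable_restrict_space1 in auto)
  also have "\<dots> = (\<integral>x. \<bar>g x\<bar> *\<^sub>R h x \<partial>lebesgue_on I)"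
    using g h' by (intro integral_density) auto
  finally show ?thesis by (simp add: mult.commute)
qed

text \<open>
  The exceptional set need not be Borel, so it is covered by a Borel set that is still null for the
  measure: a Lebesgue set is the union of a Borel set and a subset of a Borel null set.
\<close>

lemma AE_mass_measure:
  assumes I: "I \<in> sets lebesgue" and g: "g \<in> borel_measurable (lebesgue_on I)"
    and Q: "AE x in lebesgue_on I. g x \<noteq> 0 \<longrightarrow> Q x"
  shows "AE x in mass_measure I g. Q x"
proof -
  obtain N where N: "N \<in> null_sets (lebesgue_on I)"
    and NQ: "\<And>x. x \<in> space (lebesgue_on I) - N \<Longrightarrow> g x \<noteq> 0 \<longrightarrow> Q x"
    using AE_E3[OF Q] by metis
  let ?K = "{x \<in> I. g x = 0} \<union> N"
  have "{x \<in> space (lebesgue_on I). g x = 0} \<in> sets (lebesgue_on I)"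
    using g by measurable
  then have "?K \<in> sets (lebesgue_on I)" using N by auto
  then have "?K \<in> sets (completion lborel)" using I by (simp add: sets_restrict_space_iff)
  then obtain S N1 N' where K: "?K = S \<union> N1" "N1 \<subseteq> N'" "N' \<in> null_sets lborel" "S \<in> sets lborel"
    by (rule sets_completionE)
  let ?A = "(S \<union> N') \<inter> I"
  have A: "?A \<in> sets (restrict_space borel I)"
  proof -
    have "S \<union> N' \<in> sets borel"
      using sets.Un[OF K(4) null_setsD2[OF K(3)]] by simp
    then have "I \<inter> (S \<union> N') \<in> sets (restrict_space borel I)" unfolding sets_restrict_space by blast
    then show ?thesis by (simp only: Int_commute)
  qed
  have N'AE: "AE x in lebesgue_on I. x \<notin> N'"
    using AE_not_in[OF null_sets_completionI[OF K(3)]] I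
    by (subst AE_restrict_space_iff) (auto elim!: eventually_mono)
  have "emeasure (mass_measure I g) ?A = 0"
  proof -
    have "(\<integral>\<^sup>+x. ennreal \<bar>g x\<bar> * indicator ?A x \<partial>lebesgue_on I) = (\<integral>\<^sup>+x. 0 \<partial>lebesgue_on I)"
    proof (rule nn_integral_cong_AE)
      show "AE x in lebesgue_on I. ennreal \<bar>g x\<bar> * indicator ?A x = 0"
        using AE_not_in[OF N] N'AE by eventually_elim (use K(1) in \<open>auto simp: indicator_def\<close>)
    qed
    then show ?thesis by (simp add: emeasure_mass_measure[OF I g A])
  qed
  moreover have "{x \<in> space (mass_measure I g). \<not> Q x} \<subseteq> ?A" using NQ K(1,2) by auto
  ultimately show ?thesis using A by (intro AE_I[where N = ?A]) auto
qed

section \<open>Couplings and the transport cost\<close>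

text \<open>
  The infimum over an empty set of couplings would be an unspecified real number. The normalized
  product measure rules this out.
\<close>

lemma couplings_nonempty:
  assumes M: "finite_measure M" and N: "finite_measure N"
    and m: "emeasure M (space M) = ennreal m" "emeasure N (space N) = ennreal m" "m > 0"
  shows "couplings M N \<noteq> {}"
proof -
  interpret M: finite_measure M by fact
  interpret N: finite_measure N by fact
  interpret pair_sigma_finite M N ..
  let ?\<gamma> = "scale_measure (ennreal (1 / m)) (M \<Otimes>\<^sub>M N)"
  have one: "ennreal (1 / m) * ennreal m = 1"
    using m(3) by (simp add: ennreal_mult[symmetric])
  have "distr ?\<gamma> M fst = M"
  proof (rule measure_eqI)
    fix A assume "A \<in> sets (distr ?\<gamma> M fst)"
    then have A: "A \<in> sets M" by simp
    then have "fst -` A \<inter> space (M \<Otimes>\<^sub>M N) = A \<times> space N"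
      using sets.sets_into_space by (auto simp: space_pair_measure)
    then have "emeasure (distr ?\<gamma> M fst) A = ennreal (1 / m) * (emeasure M A * ennreal m)"
      using A m by (subst emeasure_distr) (auto simp: N.emeasure_pair_measure_Times space_scale_measure)
    then show "emeasure (distr ?\<gamma> M fst) A = emeasure M A"
      using one by (metis mult.commute mult.left_commute mult.right_neutral)
  qed simp
  moreover have "distr ?\<gamma> N snd = N"
  proof (rule measure_eqI)
    fix A assume "A \<in> sets (distr ?\<gamma> N snd)"
    then have A: "A \<in> sets N" by simp
    then have "snd -` A \<inter> space (M \<Otimes>\<^sub>M N) = space M \<times> A"
      using sets.sets_into_space by (auto simp: space_pair_measure)
    then have "emeasure (distr ?\<gamma> N snd) A = ennreal (1 / m) * (ennreal m * emeasure N A)"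
      using A m by (subst emeasure_distr) (auto simp: N.emeasure_pair_measure_Times space_scale_measure)
    then show "emeasure (distr ?\<gamma> N snd) A = emeasure N A"
      using one by (metis mult.assoc mult_1)
  qed simp
  ultimately have "?\<gamma> \<in> couplings M N" by (simp add: couplings_def)
  then show ?thesis by blast
qed

lemma wasserstein_ge:
  assumes "couplings M N \<noteq> {}" "0 \<le> b" "p \<ge> 1"
    and "\<And>\<gamma>. \<gamma> \<in> couplings M N \<Longrightarrow> b \<le> (\<integral>(x, y). \<bar>x - y\<bar> powr p \<partial>\<gamma>)"
  shows "b powr (1 / p) \<le> wasserstein p M N"
  unfolding wasserstein_def using assms by (intro cINF_greatest powr_mono2) auto

lemma wasserstein_le:
  assumes "\<gamma> \<in> couplings M N"
  shows "wasserstein p M N \<le> (\<integral>(x, y). \<bar>x - y\<bar> powr p \<partial>\<gamma>) powr (1 / p)"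
  unfolding wasserstein_def using assms
  by (intro cINF_lower bdd_belowI2[where m = 0]) auto

text \<open>
  Convexity of \<open>t \<mapsto> t\<^sup>p\<close>. The tangent makes the bound for general \<open>p\<close> a consequence of the one
  for \<open>p = 1\<close>, which is linear in the coupling.
\<close>

lemma powr_tangent:
  fixes d p t :: real
  assumes "d > 0" "p \<ge> 1" "t \<ge> 0"
  shows "d powr p + p * d powr (p - 1) * (t - d) \<le> t powr p"
proof (cases "t = 0")
  case True
  have "d powr p = d powr (p - 1) * d"
    using assms by (simp add: powr_diff)
  then show ?thesis using assms True by (simp add: mult_le_cancel_right1)
next
  case False
  have "convex_on {0<..} (\<lambda>t::real. t powr p)"
  proof (rule f''_ge0_imp_convex)
    show "convex {(0::real)<..}" by simp
    show "((\<lambda>t. t powr p) has_real_derivative p * x powr (p - 1)) (at x)" if "x \<in> {0<..}" for x :: real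
      using that by (auto intro!: derivative_eq_intros)
    show "((\<lambda>t. p * t powr (p - 1)) has_real_derivative p * ((p - 1) * x powr (p - 2))) (at x)"
      if "x \<in> {0<..}" for x :: real
      using that by (auto intro!: derivative_eq_intros simp: diff_diff_eq)
    show "0 \<le> p * ((p - 1) * x powr (p - 2))" for x :: real
      using assms by auto
  qed
  then have "p * d powr (p - 1) * (t - d) \<le> t powr p - d powr p"
    using assms False
    by (intro convex_on_imp_above_tangent[where A = "{0<..}"])
       (auto intro!: derivative_eq_intros simp: interior_open has_field_derivative_at_within)
  then show ?thesis by simp
qed

section \<open>Lower bound for the cost of a coupling\<close>

locale balanced_function =
  fixes I :: "real set" and f :: "real \<Rightarrow> real"
  assumes I_open: "open I" and I_bounded: "bounded I"
    and I_interval: "is_interval I"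
    and bounded_f: "mem_Linf I f"
    and nonzero: "\<not> (AE x in lebesgue_on I. f x = 0)"
    and mean_zero: "(\<integral>x. f x \<partial>lebesgue_on I) = 0"
begin

abbreviation "height \<equiv> Linf_norm I f"
abbreviation "mass \<equiv> L1_norm I f / 2"

lemma I_lmeasurable: "I \<in> lmeasurable"
  using I_open I_bounded lmeasurable_open by blast

lemma I_lebesgue: "I \<in> sets lebesgue" "I \<in> sets borel"
  using I_open by auto

lemma finite_I: "finite_measure (lebesgue_on I)"
  by (rule finite_measure_lebesgue_on[OF I_lmeasurable])

lemma f_measurable [measurable]: "f \<in> borel_measurable (lebesgue_on I)"
  using bounded_f by (simp add: mem_Linf_def)

lemma AE_le_height: "AE x in lebesgue_on I. \<bar>f x\<bar> \<le> height"
  and height_nonneg: "0 \<le> height"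
proof -
  have ess: "AE x in lebesgue_on I. ereal \<bar>f x\<bar> \<le> Linf_enorm I f"
    unfolding Linf_enorm_def by (rule esssup_AE)
  have "\<not> Linf_enorm I f < 0"
  proof
    assume neg: "Linf_enorm I f < 0"
    have "AE x in lebesgue_on I. f x = 0"
      using ess
    proof eventually_elim
      case (elim x)
      then have "ereal \<bar>f x\<bar> < 0" using neg by (rule order.strict_trans1)
      then show ?case by simp
    qed
    then show False using nonzero by simp
  qed
  then have eq: "Linf_enorm I f = ereal height" and "0 \<le> height"
    using bounded_f unfolding mem_Linf_def Linf_norm_def
    by (cases "Linf_enorm I f"; simp)+
  then show "0 \<le> height" "AE x in lebesgue_on I. \<bar>f x\<bar> \<le> height"
    using ess by auto
qed

lemma height_pos: "0 < height"
proof (rule ccontr)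
  assume "\<not> 0 < height"
  then have "AE x in lebesgue_on I. f x = 0"
    using AE_le_height by (auto elim!: eventually_mono)
  then show False using nonzero by simp
qed

lemma integrable_bounded:
  fixes h :: "real \<Rightarrow> real"
  assumes "h \<in> borel_measurable (lebesgue_on I)" "AE x in lebesgue_on I. \<bar>h x\<bar> \<le> B"
  shows "integrable (lebesgue_on I) h"
  using assms by (intro finite_measure.integrable_const_bound[OF finite_I, of _ B]) auto

lemma f_integrable: "integrable (lebesgue_on I) f"
  using AE_le_height by (rule integrable_bounded[OF f_measurable])

lemma mass_pos: "0 < mass"
proof -
  have "L1_norm I f \<noteq> 0"
    using nonzero f_integrable unfolding L1_norm_def
    by (subst integral_nonneg_eq_0_iff_AE) auto
  moreover have "0 \<le> L1_norm I f" unfolding L1_norm_def by simp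
  ultimately show ?thesis by simp
qed

lemma f_plus_measurable [measurable]: "f_plus f \<in> borel_measurable (lebesgue_on I)"
  unfolding f_plus_def[abs_def] by measurable

lemma f_minus_measurable [measurable]: "f_minus f \<in> borel_measurable (lebesgue_on I)"
  unfolding f_minus_def[abs_def] by measurable

lemma f_parts_integrable:
  "integrable (lebesgue_on I) (f_plus f)" "integrable (lebesgue_on I) (f_minus f)"
  using f_integrable unfolding f_plus_def[abs_def] f_minus_def[abs_def] by auto

lemma integral_parts:
  "(\<integral>x. \<bar>f_plus f x\<bar> \<partial>lebesgue_on I) = mass" "(\<integral>x. \<bar>f_minus f x\<bar> \<partial>lebesgue_on I) = mass"
proof -
  have eq: "(\<lambda>x. \<bar>f_plus f x\<bar>) = (\<lambda>x. (\<bar>f x\<bar> + f x) / 2)"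
    "(\<lambda>x. \<bar>f_minus f x\<bar>) = (\<lambda>x. (\<bar>f x\<bar> - f x) / 2)"
    by (auto simp: f_plus_def f_minus_def fun_eq_iff)
  show "(\<integral>x. \<bar>f_plus f x\<bar> \<partial>lebesgue_on I) = mass"
    "(\<integral>x. \<bar>f_minus f x\<bar> \<partial>lebesgue_on I) = mass"
    unfolding eq using f_integrable mean_zero by (simp_all add: L1_norm_def)
qed

lemma emeasure_parts:
  "emeasure (mass_measure I (f_plus f)) I = ennreal mass"
  "emeasure (mass_measure I (f_minus f)) I = ennreal mass"
proof -
  have "emeasure (mass_measure I g) I = ennreal (\<integral>x. \<bar>g x\<bar> \<partial>lebesgue_on I)"
    if g: "integrable (lebesgue_on I) g" for g
  proof -
    have "I \<in> sets (restrict_space borel I)"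
      by (metis sets.top space_borel space_restrict_space inf_top_right)
    then have "emeasure (mass_measure I g) I = (\<integral>\<^sup>+x. ennreal \<bar>g x\<bar> \<partial>lebesgue_on I)"
      using g I_lebesgue by (subst emeasure_mass_measure) (auto intro!: nn_integral_cong)
    then show ?thesis using g by (simp add: nn_integral_eq_integral)
  qed
  then show "emeasure (mass_measure I (f_plus f)) I = ennreal mass"
    "emeasure (mass_measure I (f_minus f)) I = ennreal mass"
    by (simp_all only: f_parts_integrable integral_parts)
qed

lemma couplings_parts_nonempty:
  "couplings (mass_measure I (f_plus f)) (mass_measure I (f_minus f)) \<noteq> {}"
  using emeasure_parts mass_pos
  by (intro couplings_nonempty[where m = mass]) (auto intro!: finite_measureI)

text \<open>
  The right-hand side of \<open>|x - y| \<ge> \<delta> x + \<delta> y\<close> splits into functions of one variable, so its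
  integral depends only on the marginals of \<open>\<gamma>\<close>. Combined with the tangent of \<open>t\<^sup>p\<close> at \<open>d\<close>, this bounds
  the cost of all couplings by the same number.
\<close>

lemma transport_cost_ge:
  assumes \<gamma>: "\<gamma> \<in> couplings (mass_measure I (f_plus f)) (mass_measure I (f_minus f))"
    and sep: "separates I Z f" and d: "d > 0" and p: "p \<ge> 1"
  shows "mass * d powr p + p * d powr (p - 1) * ((\<integral>x. infdist x Z * \<bar>f x\<bar> \<partial>lebesgue_on I) - d * mass)
         \<le> (\<integral>(x, y). \<bar>x - y\<bar> powr p \<partial>\<gamma>)"
proof -
  let ?M = "mass_measure I (f_plus f)" and ?N = "mass_measure I (f_minus f)"
  have sets_\<gamma>: "sets \<gamma> = sets (?M \<Otimes>\<^sub>M ?N)" and fst_\<gamma>: "distr \<gamma> ?M fst = ?M"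
    and snd_\<gamma>: "distr \<gamma> ?N snd = ?N"
    using \<gamma> by (auto simp: couplings_def)
  have space_\<gamma>: "space \<gamma> = I \<times> I"
    using sets_eq_imp_space_eq[OF sets_\<gamma>] by (simp add: space_pair_measure)
  have fst_M: "fst \<in> \<gamma> \<rightarrow>\<^sub>M ?M" and snd_N: "snd \<in> \<gamma> \<rightarrow>\<^sub>M ?N"
    using measurable_cong_sets[OF sets_\<gamma> refl] by auto
  have id_borel: "(\<lambda>x. x) \<in> borel_measurable (mass_measure I g)" for g
    by (subst measurable_cong_sets[OF sets_mass_measure refl]) (simp add: measurable_restrict_space1)
  have [measurable]: "fst \<in> borel_measurable \<gamma>" "snd \<in> borel_measurable \<gamma>"
    using measurable_compose[OF fst_M id_borel] measurable_compose[OF snd_N id_borel] by auto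
  have total: "emeasure \<gamma> (space \<gamma>) = ennreal mass"
  proof -
    have "emeasure \<gamma> (space \<gamma>) = emeasure (distr \<gamma> ?M fst) I"
      using fst_M space_\<gamma>
      by (subst emeasure_distr) (auto simp: sets_restrict_space intro!: arg_cong2[where f = emeasure])
    then show ?thesis using fst_\<gamma> emeasure_parts by simp
  qed
  then interpret \<gamma>: finite_measure \<gamma> by (intro finite_measureI) simp
  have total': "measure \<gamma> (space \<gamma>) = mass" using total mass_pos by (simp add: measure_def)
  obtain B where B: "\<And>x. x \<in> I \<Longrightarrow> \<bar>x\<bar> \<le> B"
    using I_bounded by (auto simp: bounded_real)
  let ?\<delta> = "\<lambda>x. infdist x Z"
  have \<delta>_borel [measurable]: "?\<delta> \<in> borel_measurable borel"
    by (intro borel_measurable_continuous_onI continuous_intros)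
  have \<delta>_bound: "\<bar>?\<delta> x\<bar> \<le> \<bar>?\<delta> 0\<bar> + B" if "x \<in> I" for x
    using infdist_triangle[of x Z 0] B[OF that] by (simp add: infdist_nonneg)
  obtain E where E: "negligible E" and sepE: "\<And>x y. x \<in> I - E \<Longrightarrow> y \<in> I - E \<Longrightarrow> f x > 0 \<Longrightarrow> f y < 0
      \<Longrightarrow> \<exists>z\<in>Z. z \<in> closed_segment x y"
    using sep unfolding separates_def by blast
  have notE: "AE x in lebesgue_on I. x \<in> I - E"
    using AE_not_in[OF E[unfolded negligible_iff_null_sets]] I_lebesgue
    by (subst AE_restrict_space_iff) (auto elim!: eventually_mono)
  have "AE x in lebesgue_on I. f_plus f x \<noteq> 0 \<longrightarrow> x \<in> I - E \<and> f x > 0"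
    using notE by eventually_elim (auto simp: f_plus_def max_def split: if_splits)
  then have "AE x in ?M. x \<in> I - E \<and> f x > 0"
    by (intro AE_mass_measure I_lebesgue f_plus_measurable)
  then have AE1: "AE w in \<gamma>. fst w \<in> I - E \<and> f (fst w) > 0"
    by (intro AE_distrD[OF fst_M, of "\<lambda>x. x \<in> I - E \<and> f x > 0"]) (simp only: fst_\<gamma>)
  have "AE x in lebesgue_on I. f_minus f x \<noteq> 0 \<longrightarrow> x \<in> I - E \<and> f x < 0"
    using notE by eventually_elim (auto simp: f_minus_def max_def split: if_splits)
  then have "AE x in ?N. x \<in> I - E \<and> f x < 0"
    by (intro AE_mass_measure I_lebesgue f_minus_measurable)
  then have AE2: "AE w in \<gamma>. snd w \<in> I - E \<and> f (snd w) < 0"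
    by (intro AE_distrD[OF snd_N, of "\<lambda>x. x \<in> I - E \<and> f x < 0"]) (simp only: snd_\<gamma>)
  \<comment> \<open>A path from \<open>x\<close> to \<open>y\<close> passes through a point \<open>z\<close> of \<open>Z\<close>.\<close>
  have detour: "AE w in \<gamma>. ?\<delta> (fst w) + ?\<delta> (snd w) \<le> \<bar>fst w - snd w\<bar>"
    using AE1 AE2
  proof eventually_elim
    case (elim w)
    then obtain z where z: "z \<in> Z" "z \<in> closed_segment (fst w) (snd w)" using sepE by blast
    have "?\<delta> (fst w) \<le> \<bar>fst w - z\<bar>" "?\<delta> (snd w) \<le> \<bar>snd w - z\<bar>"
      using infdist_le[OF z(1)] by (simp_all add: dist_real_def)
    then show ?case using z(2) by (auto simp: closed_segment_eq_real_ivl split: if_splits)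
  qed
  have int_\<delta>1: "integrable \<gamma> (\<lambda>w. ?\<delta> (fst w))"
    by (rule \<gamma>.integrable_const_bound[where B = "\<bar>?\<delta> 0\<bar> + B"]) (auto simp: space_\<gamma> \<delta>_bound intro!: AE_I2)
  have int_\<delta>2: "integrable \<gamma> (\<lambda>w. ?\<delta> (snd w))"
    by (rule \<gamma>.integrable_const_bound[where B = "\<bar>?\<delta> 0\<bar> + B"]) (auto simp: space_\<gamma> \<delta>_bound intro!: AE_I2)
  have int_cost: "integrable \<gamma> (\<lambda>w. \<bar>fst w - snd w\<bar> powr p)"
  proof (rule \<gamma>.integrable_const_bound[where B = "(2 * B) powr p"])
    show "AE w in \<gamma>. norm (\<bar>fst w - snd w\<bar> powr p) \<le> (2 * B) powr p"
    proof (rule AE_I2)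
      fix w assume "w \<in> space \<gamma>"
      then have "\<bar>fst w - snd w\<bar> \<le> 2 * B" using B[of "fst w"] B[of "snd w"] by (auto simp: space_\<gamma>)
      then show "norm (\<bar>fst w - snd w\<bar> powr p) \<le> (2 * B) powr p" using p by (simp add: powr_mono2)
    qed
  qed measurable
  have "(\<integral>w. ?\<delta> (fst w) \<partial>\<gamma>) = (\<integral>x. ?\<delta> x \<partial>?M)"
    using integral_distr[OF fst_M, of ?\<delta>] fst_\<gamma> measurable_compose[OF id_borel \<delta>_borel] by simp
  also have "\<dots> = (\<integral>x. ?\<delta> x * \<bar>f_plus f x\<bar> \<partial>lebesgue_on I)"
    by (rule integral_mass_measure) measurable
  finally have i1: "(\<integral>w. ?\<delta> (fst w) \<partial>\<gamma>) = (\<integral>x. ?\<delta> x * \<bar>f_plus f x\<bar> \<partial>lebesgue_on I)" .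
  have "(\<integral>w. ?\<delta> (snd w) \<partial>\<gamma>) = (\<integral>x. ?\<delta> x \<partial>?N)"
    using integral_distr[OF snd_N, of ?\<delta>] snd_\<gamma> measurable_compose[OF id_borel \<delta>_borel] by simp
  also have "\<dots> = (\<integral>x. ?\<delta> x * \<bar>f_minus f x\<bar> \<partial>lebesgue_on I)"
    by (rule integral_mass_measure) measurable
  finally have i2: "(\<integral>w. ?\<delta> (snd w) \<partial>\<gamma>) = (\<integral>x. ?\<delta> x * \<bar>f_minus f x\<bar> \<partial>lebesgue_on I)" .
  have \<delta>_leb: "?\<delta> \<in> borel_measurable (lebesgue_on I)"
    using \<delta>_borel by (intro measurable_restrict_space1 measurable_completion) simp
  have intM: "integrable (lebesgue_on I) (\<lambda>x. ?\<delta> x * \<bar>f_plus f x\<bar>)"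
    and intN: "integrable (lebesgue_on I) (\<lambda>x. ?\<delta> x * \<bar>f_minus f x\<bar>)"
  proof -
    have "AE x in lebesgue_on I. \<bar>?\<delta> x * \<bar>f_plus f x\<bar>\<bar> \<le> (\<bar>?\<delta> 0\<bar> + B) * height"
      using AE_le_height notE
      by eventually_elim (auto simp: abs_mult f_plus_def intro!: mult_mono order_trans[OF _ \<delta>_bound])
    moreover have "AE x in lebesgue_on I. \<bar>?\<delta> x * \<bar>f_minus f x\<bar>\<bar> \<le> (\<bar>?\<delta> 0\<bar> + B) * height"
      using AE_le_height notE
      by eventually_elim (auto simp: abs_mult f_minus_def intro!: mult_mono order_trans[OF _ \<delta>_bound])
    ultimately show "integrable (lebesgue_on I) (\<lambda>x. ?\<delta> x * \<bar>f_plus f x\<bar>)"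
      "integrable (lebesgue_on I) (\<lambda>x. ?\<delta> x * \<bar>f_minus f x\<bar>)"
      using \<delta>_leb by (auto intro!: integrable_bounded)
  qed
  have sum_\<delta>: "(\<integral>w. ?\<delta> (fst w) \<partial>\<gamma>) + (\<integral>w. ?\<delta> (snd w) \<partial>\<gamma>) = (\<integral>x. ?\<delta> x * \<bar>f x\<bar> \<partial>lebesgue_on I)"
    unfolding i1 i2 Bochner_Integration.integral_add[OF intM intN, symmetric]
    by (intro Bochner_Integration.integral_cong) (auto simp: f_plus_def f_minus_def max_def)
  let ?low = "\<lambda>w. (d powr p - p * d powr (p - 1) * d) + p * d powr (p - 1) * (?\<delta> (fst w) + ?\<delta> (snd w))"
  have "(\<integral>w. ?low w \<partial>\<gamma>) \<le> (\<integral>w. \<bar>fst w - snd w\<bar> powr p \<partial>\<gamma>)"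
  proof (rule integral_mono_AE)
    show "AE w in \<gamma>. ?low w \<le> \<bar>fst w - snd w\<bar> powr p"
      using detour
    proof eventually_elim
      case (elim w)
      have "?low w \<le> d powr p + p * d powr (p - 1) * (\<bar>fst w - snd w\<bar> - d)"
        using mult_left_mono[OF elim, of "p * d powr (p - 1)"] p by (simp add: algebra_simps)
      also have "\<dots> \<le> \<bar>fst w - snd w\<bar> powr p" using d p by (intro powr_tangent) auto
      finally show ?case .
    qed
  qed (use int_\<delta>1 int_\<delta>2 int_cost in auto)
  moreover have "(\<integral>w. ?low w \<partial>\<gamma>) =
     mass * (d powr p - p * d powr (p - 1) * d) + p * d powr (p - 1) * (\<integral>x. ?\<delta> x * \<bar>f x\<bar> \<partial>lebesgue_on I)"
    using int_\<delta>1 int_\<delta>2 sum_\<delta> total' by simp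
  ultimately show ?thesis by (simp add: algebra_simps case_prod_unfold)
qed

lemma W_parts_ge:
  assumes "separates I Z f" "d > 0" "p \<ge> 1"
    and "d * mass \<le> (\<integral>x. infdist x Z * \<bar>f x\<bar> \<partial>lebesgue_on I)"
  shows "(mass * d powr p + p * d powr (p - 1) * ((\<integral>x. infdist x Z * \<bar>f x\<bar> \<partial>lebesgue_on I) - d * mass))
           powr (1 / p) \<le> W_parts p I f"
  unfolding W_parts_def
  by (rule wasserstein_ge[OF couplings_parts_nonempty _ _ transport_cost_ge])
     (use assms mass_pos in auto)

end

section \<open>The bathtub principle for the distance to a finite set\<close>

text \<open>
  Nonempty open sets are not null, so a statement that holds almost everywhere holds somewhere in
  each of them. In this form, equalities of integrals yield exact inclusions between open sets.
\<close>

lemma AE_lebesgue_open_witness: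
  fixes S :: "real set"
  assumes "AE x in lebesgue. Q x" "open S" "S \<noteq> {}"
  obtains x where "x \<in> S" "Q x"
proof -
  obtain N where N': "{x \<in> space lebesgue. \<not> Q x} \<subseteq> N" "emeasure lebesgue N = 0" "N \<in> sets lebesgue"
    using AE_E[OF assms(1)] by metis
  then have N: "N \<in> null_sets lebesgue" "{x. \<not> Q x} \<subseteq> N"
    by (simp_all add: null_setsI del: emeasure_completion)
  have "\<not> S \<subseteq> N"
    using open_not_negligible[OF assms(2,3)] N(1) negligible_subset
    by (auto simp: negligible_iff_null_sets)
  then show ?thesis using that N(2) by blast
qed

lemma AE_lebesgue_on_iff:
  assumes "I \<in> sets lebesgue"
  shows "(AE x in lebesgue_on I. Q x) \<longleftrightarrow> (AE x in lebesgue. x \<in> I \<longrightarrow> Q x)"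
  using assms by (subst AE_restrict_space_iff) auto

lemma ramp_integrals:
  fixes a d :: real
  assumes "d \<ge> 0"
  shows "has_bochner_integral lborel (\<lambda>x. (x - a) * indicator {a..a + d} x) (d\<^sup>2 / 2)"
    and "has_bochner_integral lborel (\<lambda>x. (a + d - x) * indicator {a..a + d} x) (d\<^sup>2 / 2)"
proof -
  have "has_bochner_integral lborel (\<lambda>x. (x - a) * indicator {a..a + d} x)
      ((a + d - a)\<^sup>2 / 2 - (a - a)\<^sup>2 / 2)"
    using assms by (intro has_bochner_integral_FTC_Icc_real) (auto intro!: derivative_eq_intros)
  then show "has_bochner_integral lborel (\<lambda>x. (x - a) * indicator {a..a + d} x) (d\<^sup>2 / 2)"
    by simp
  have "has_bochner_integral lborel (\<lambda>x. (a + d - x) * indicator {a..a + d} x)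
      (- ((a + d - (a + d))\<^sup>2 / 2) - (- ((a + d - a)\<^sup>2 / 2)))"
    using assms by (intro has_bochner_integral_FTC_Icc_real)
      (auto intro!: derivative_eq_intros simp: field_simps)
  then show "has_bochner_integral lborel (\<lambda>x. (a + d - x) * indicator {a..a + d} x) (d\<^sup>2 / 2)"
    by simp
qed

lemma infdist_less_iff_ball:
  fixes Z :: "real set"
  assumes "finite Z" "Z \<noteq> {}"
  shows "infdist x Z < d \<longleftrightarrow> x \<in> (\<Union>z\<in>Z. {z - d<..<z + d})"
proof
  assume "infdist x Z < d"
  moreover obtain z where "z \<in> Z" "infdist x Z = dist x z"
    using infdist_attains_inf[of Z x] assms finite_imp_closed by blast
  ultimately show "x \<in> (\<Union>z\<in>Z. {z - d<..<z + d})"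
    by (auto simp: dist_real_def intro!: bexI[of _ z])
next
  assume "x \<in> (\<Union>z\<in>Z. {z - d<..<z + d})"
  then obtain z where "z \<in> Z" "\<bar>x - z\<bar> < d" by force
  then show "infdist x Z < d" using infdist_le[of z Z x] by (simp add: dist_real_def)
qed

context balanced_function
begin

text \<open>
  With \<open>\<delta> x = infdist x Z\<close> one has
  \<open>(\<delta> - d) |f| \<ge> - height * max 0 (d - \<delta>)\<close>, with equality only if \<open>|f| = height\<close> where \<open>\<delta> < d\<close> and
  \<open>f = 0\<close> where \<open>\<delta> > d\<close>. The positive part of \<open>d - \<delta>\<close> is at most the sum of the tents of height
  \<open>d\<close> and radius \<open>d\<close> centred at the points of \<open>Z\<close>, each of which has area \<open>d\<^sup>2\<close>. This sum may be
  used even if the tents overlap or leave \<open>I\<close>, which makes the bound independent of the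
  position of \<open>Z\<close>.
\<close>

lemma
  assumes Z: "finite Z" "Z \<noteq> {}" and d: "d \<ge> 0"
  shows bathtub: "d * L1_norm I f - height * card Z * d\<^sup>2
      \<le> (\<integral>x. infdist x Z * \<bar>f x\<bar> \<partial>lebesgue_on I)"
    and bathtub_equality:
      "(\<integral>x. infdist x Z * \<bar>f x\<bar> \<partial>lebesgue_on I) \<le> d * L1_norm I f - height * card Z * d\<^sup>2
       \<Longrightarrow> AE x in lebesgue_on I. \<bar>f x\<bar> = height * indicator (\<Union>z\<in>Z. {z - d<..<z + d}) x"
proof -
  let ?low = "d * L1_norm I f - height * card Z * d\<^sup>2"
  let ?A = "\<integral>x. infdist x Z * \<bar>f x\<bar> \<partial>lebesgue_on I"
  let ?\<delta> = "\<lambda>x. infdist x Z"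
  define tent where "tent x = (\<Sum>z\<in>Z. (x - (z - d)) * indicator {z - d..z} x
      + (z + d - x) * indicator {z..z + d} x)" for x
  have tent_int: "has_bochner_integral lborel tent (card Z * d\<^sup>2)"
  proof -
    have "has_bochner_integral lborel tent (\<Sum>z\<in>Z. d\<^sup>2 / 2 + d\<^sup>2 / 2)"
      unfolding tent_def[abs_def] using ramp_integrals(1)[OF d, of "z - d" for z] ramp_integrals(2)[OF d]
      by (intro has_bochner_integral_sum has_bochner_integral_add) (simp_all only: diff_add_cancel)
    then show ?thesis by simp
  qed
  have tent_term: "0 \<le> (x - (z - d)) * indicator {z - d..z} x + (z + d - x) * indicator {z..z + d} x" for x z
    by (auto simp: indicator_def)
  have tent_nonneg: "0 \<le> tent x" for x
    unfolding tent_def by (intro sum_nonneg tent_term)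
  have tent_ge: "d - ?\<delta> x \<le> tent x" for x
  proof (cases "?\<delta> x < d")
    case True
    obtain z where z: "z \<in> Z" "?\<delta> x = \<bar>x - z\<bar>"
      using infdist_attains_inf[of Z x] Z finite_imp_closed unfolding dist_real_def by blast
    have "d - \<bar>x - z\<bar> \<le> (x - (z - d)) * indicator {z - d..z} x + (z + d - x) * indicator {z..z + d} x"
      using True z by (auto simp: indicator_def)
    also have "\<dots> \<le> tent x"
      unfolding tent_def by (rule member_le_sum[OF z(1) tent_term Z(1)])
    finally show ?thesis using z by simp
  next
    case False
    then show ?thesis using tent_nonneg[of x] by simp
  qed
  have tent_leb: "integrable lebesgue tent" "(\<integral>x. tent x \<partial>lebesgue) = card Z * d\<^sup>2"
    using tent_int by (auto simp: integrable_completion integral_completion has_bochner_integral_iff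
        dest: borel_measurable_has_bochner_integral)
  have tent_I: "integrable (lebesgue_on I) tent"
    using integrable_mult_indicator[OF I_lebesgue(1) tent_leb(1)] I_lebesgue(1)
    by (subst integrable_restrict_space) auto
  have tent_le: "(\<integral>x. tent x \<partial>lebesgue_on I) \<le> card Z * d\<^sup>2"
  proof -
    have "(\<integral>x. indicator I x *\<^sub>R tent x \<partial>lebesgue) \<le> (\<integral>x. tent x \<partial>lebesgue)"
      using tent_nonneg
      by (intro integral_mono integrable_mult_indicator I_lebesgue tent_leb) (simp add: indicator_def)
    then show ?thesis using I_lebesgue(1) tent_leb(2) by (subst integral_restrict_space) auto
  qed
  define excess where "excess x = (?\<delta> x - d) * \<bar>f x\<bar> + height * tent x" for x
  have excess_ge: "excess x \<ge> (if ?\<delta> x < d then (d - ?\<delta> x) * (height - \<bar>f x\<bar>) else (?\<delta> x - d) * \<bar>f x\<bar>)" for x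
    using mult_left_mono[OF tent_ge[of x] height_nonneg] mult_nonneg_nonneg[OF height_nonneg tent_nonneg[of x]]
    unfolding excess_def by (auto simp: algebra_simps)
  have excess_nonneg: "AE x in lebesgue_on I. 0 \<le> excess x"
    using AE_le_height
  proof eventually_elim
    case (elim x)
    have "0 \<le> (if ?\<delta> x < d then (d - ?\<delta> x) * (height - \<bar>f x\<bar>) else (?\<delta> x - d) * \<bar>f x\<bar>)"
      using elim by auto
    then show ?case using excess_ge[of x] by linarith
  qed
  obtain B where B: "\<And>x. x \<in> I \<Longrightarrow> \<bar>x\<bar> \<le> B"
    using I_bounded by (auto simp: bounded_real)
  have \<delta>_leb: "?\<delta> \<in> borel_measurable (lebesgue_on I)"
    by (intro continuous_imp_measurable_on_sets_lebesgue continuous_intros) (use I_lebesgue in auto)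
  have int_\<delta>f: "integrable (lebesgue_on I) (\<lambda>x. ?\<delta> x * \<bar>f x\<bar>)"
  proof (rule integrable_bounded)
    show "AE x in lebesgue_on I. \<bar>?\<delta> x * \<bar>f x\<bar>\<bar> \<le> (\<bar>?\<delta> 0\<bar> + B) * height"
      using AE_le_height AE_space[of "lebesgue_on I"]
    proof eventually_elim
      case (elim x)
      have "?\<delta> x \<le> \<bar>?\<delta> 0\<bar> + B" using infdist_triangle[of x Z 0] B[of x] elim by simp
      then have "\<bar>?\<delta> x\<bar> \<le> \<bar>?\<delta> 0\<bar> + B" by (simp add: infdist_nonneg)
      then show ?case using elim(1) unfolding abs_mult by (intro mult_mono) auto
    qed
  qed (use \<delta>_leb in measurable)
  have excess_int: "integrable (lebesgue_on I) excess"
    using int_\<delta>f f_integrable tent_I unfolding excess_def[abs_def]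
    by (simp add: left_diff_distrib)
  have "(\<integral>x. excess x \<partial>lebesgue_on I)
      = ?A - d * L1_norm I f + height * (\<integral>x. tent x \<partial>lebesgue_on I)"
    using int_\<delta>f f_integrable tent_I unfolding excess_def L1_norm_def
    by (simp add: left_diff_distrib)
  also have "\<dots> \<le> ?A - ?low"
    using mult_left_mono[OF tent_le height_nonneg] by simp
  finally have upper: "(\<integral>x. excess x \<partial>lebesgue_on I) \<le> ?A - ?low" .
  have "0 \<le> (\<integral>x. excess x \<partial>lebesgue_on I)"
    using excess_nonneg by (rule integral_nonneg_AE)
  then show "?low \<le> ?A" using upper by linarith
  assume "?A \<le> ?low"
  then have "(\<integral>x. excess x \<partial>lebesgue_on I) = 0"
    using upper \<open>0 \<le> (\<integral>x. excess x \<partial>lebesgue_on I)\<close> by linarith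
  then have zero: "AE x in lebesgue_on I. excess x = 0"
    using integral_nonneg_eq_0_iff_AE[OF excess_int excess_nonneg] by simp
  \<comment> \<open>The points at distance exactly \<open>d\<close> from \<open>Z\<close> are not controlled; they form a finite set.\<close>
  have "negligible ((\<lambda>z. z - d) ` Z \<union> (\<lambda>z. z + d) ` Z)"
    using Z by (intro negligible_finite) auto
  then have "AE x in lebesgue. x \<notin> (\<lambda>z. z - d) ` Z \<union> (\<lambda>z. z + d) ` Z"
    by (intro AE_not_in) (simp only: negligible_iff_null_sets)
  then have "AE x in lebesgue_on I. x \<notin> (\<lambda>z. z - d) ` Z \<union> (\<lambda>z. z + d) ` Z"
    using I_lebesgue(1) by (simp only: AE_lebesgue_on_iff) (erule eventually_mono, simp)
  then show "AE x in lebesgue_on I. \<bar>f x\<bar> = height * indicator (\<Union>z\<in>Z. {z - d<..<z + d}) x"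
    using zero AE_le_height
  proof eventually_elim
    case (elim x)
    obtain z where z: "z \<in> Z" "?\<delta> x = \<bar>x - z\<bar>"
      using infdist_attains_inf[of Z x] Z finite_imp_closed unfolding dist_real_def by blast
    then have "?\<delta> x \<noteq> d"
      using elim(1) by (auto simp: image_iff abs_if split: if_splits)
    show ?case
    proof (cases "?\<delta> x < d")
      case True
      then have "(d - ?\<delta> x) * (height - \<bar>f x\<bar>) \<le> 0" using excess_ge[of x] elim by simp
      then have "\<bar>f x\<bar> = height" using True elim by (simp add: mult_le_0_iff)
      then show ?thesis using True infdist_less_iff_ball[OF Z] by simp
    next
      case False
      then have "(?\<delta> x - d) * \<bar>f x\<bar> \<le> 0" using excess_ge[of x] elim by simp
      then have "f x = 0" using False \<open>?\<delta> x \<noteq> d\<close> by (simp add: mult_le_0_iff)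
      then show ?thesis using False infdist_less_iff_ball[OF Z] by simp
    qed
  qed
qed

end

section \<open>The lower bound\<close>

context balanced_function
begin

abbreviation "width N \<equiv> L1_norm I f / (2 * height * real N)"

text \<open>
  Otherwise \<open>f\<close> would have one sign almost everywhere, and a function of one sign with mean zero
  vanishes.
\<close>

lemma separating_set_nonempty:
  assumes "separates I Z f"
  shows "Z \<noteq> {}"
proof
  assume "Z = {}"
  then obtain E where E: "negligible E" and one_sign: "\<And>x y. x \<in> I - E \<Longrightarrow> y \<in> I - E \<Longrightarrow> f x > 0 \<Longrightarrow> \<not> f y < 0"
    using assms unfolding separates_def by blast
  have notE: "AE x in lebesgue_on I. x \<in> I - E"
    unfolding AE_lebesgue_on_iff[OF I_lebesgue(1)]
    using AE_not_in[OF E[unfolded negligible_iff_null_sets]] by (auto elim!: eventually_mono)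
  have "AE x in lebesgue_on I. f x = 0"
  proof (cases "\<exists>x\<in>I - E. f x > 0")
    case True
    have "AE x in lebesgue_on I. 0 \<le> f x"
      using notE by eventually_elim (use True one_sign in \<open>force simp: not_less\<close>)
    then show ?thesis using integral_nonneg_eq_0_iff_AE[OF f_integrable] mean_zero by simp
  next
    case False
    have "AE x in lebesgue_on I. 0 \<le> - f x"
      using notE by eventually_elim (use False in \<open>force simp: not_less\<close>)
    moreover have "(\<integral>x. - f x \<partial>lebesgue_on I) = 0" using mean_zero by simp
    ultimately have "AE x in lebesgue_on I. - f x = 0"
      using integral_nonneg_eq_0_iff_AE[of "lebesgue_on I" "\<lambda>x. - f x"] f_integrable by simp
    then show ?thesis by simp
  qed
  then show False using nonzero by simp
qed

lemma width_pos: "N > 0 \<Longrightarrow> width N > 0"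
  using height_pos mass_pos by simp

lemma bathtub_width:
  assumes "N > 0"
  shows "width N * L1_norm I f - height * real N * (width N)\<^sup>2 = width N * mass"
  using height_pos assms by (simp add: field_simps power2_eq_square)

lemma cost_root:
  assumes "d > 0" "p \<ge> 1"
  shows "(mass * d powr p) powr (1 / p) = d * mass powr (1 / p)"
proof -
  have "(m * d powr p) powr (1 / p) = d * m powr (1 / p)" if "m > 0" for m :: real
    using that assms by (simp add: powr_mult powr_powr)
  then show ?thesis using mass_pos by blast
qed

text \<open>
  For \<open>d = width (card Z)\<close>, the bathtub bound is exactly \<open>d * mass\<close>, so the first-order term in
  the cost of a coupling is nonnegative and only the constant term \<open>mass * d powr p\<close> is left.
\<close>

proposition W_parts_ge_width:
  assumes sep: "separates I Z f" and Z: "finite Z" and p: "p \<ge> 1"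
  shows "width (card Z) * mass powr (1 / p) \<le> W_parts p I f"
proof -
  let ?d = "width (card Z)" and ?A = "\<integral>x. infdist x Z * \<bar>f x\<bar> \<partial>lebesgue_on I"
  have ne: "Z \<noteq> {}" by (rule separating_set_nonempty[OF sep])
  then have N: "card Z > 0" using Z by (simp add: card_gt_0_iff)
  have d: "?d > 0" by (rule width_pos[OF N])
  have A: "?d * mass \<le> ?A"
    using bathtub[OF Z ne, of ?d] bathtub_width[OF N] d by simp
  have "?d * mass powr (1 / p) = (mass * ?d powr p) powr (1 / p)"
    using cost_root[OF d p] by simp
  also have "\<dots> \<le> (mass * ?d powr p + p * ?d powr (p - 1) * (?A - ?d * mass)) powr (1 / p)"
    using mass_pos d p A by (intro powr_mono2) auto
  also have "\<dots> \<le> W_parts p I f" by (rule W_parts_ge[OF sep d p A])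
  finally show ?thesis .
qed

end

section \<open>The case of equality\<close>

text \<open>
  The sum of the indicators of the balls minus the indicator of their union within \<open>I\<close> is
  nonnegative and has integral at most zero, so it vanishes almost everywhere. It is at least one
  on the part of a ball outside \<open>closure I\<close> and on the intersection of two balls; these sets are open,
  hence empty.
\<close>

lemma full_measure_union_packing:
  fixes I Z :: "real set" and d :: real
  assumes I: "open I" "is_interval I" and Z: "finite Z" and d: "d \<ge> 0"
    and full: "2 * d * card Z \<le> measure lebesgue (I \<inter> (\<Union>z\<in>Z. {z - d<..<z + d}))"
  shows "\<And>z. z \<in> Z \<Longrightarrow> {z - d<..<z + d} \<subseteq> I"
    and "\<And>z z'. z \<in> Z \<Longrightarrow> z' \<in> Z \<Longrightarrow> z \<noteq> z' \<Longrightarrow> {z - d<..<z + d} \<inter> {z' - d<..<z' + d} = {}"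
proof -
  let ?B = "\<lambda>z. {z - d<..<z + d}"
  let ?U = "I \<inter> (\<Union>z\<in>Z. ?B z)"
  define excess where "excess x = (\<Sum>z\<in>Z. indicator (?B z) x) - (indicator ?U x :: real)" for x
  have U: "?U \<in> lmeasurable"
    using I Z by (intro lmeasurable_open bounded_Int disjI2 bounded_UN open_Int open_UN) auto
  have B: "?B z \<in> lmeasurable" for z by simp
  have one_le: "1 \<le> (\<Sum>z\<in>Z. indicator (?B z) x :: real)" if "z \<in> Z" "x \<in> ?B z" for x z
    using member_le_sum[of z Z "\<lambda>z. indicator (?B z) x :: real"] that Z by auto
  have nonneg: "0 \<le> excess x" for x
    using one_le[of _ x] unfolding excess_def by (auto simp: indicator_def sum_nonneg)
  have int: "integrable lebesgue excess"
    unfolding excess_def[abs_def] using U B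
    by (intro Bochner_Integration.integrable_diff Bochner_Integration.integrable_sum integrable_real_indicator)
       (auto simp: fmeasurable_def)
  have "(\<integral>x. excess x \<partial>lebesgue) = (\<Sum>z\<in>Z. measure lebesgue (?B z)) - measure lebesgue ?U"
    unfolding excess_def[abs_def] using U B
    by (subst Bochner_Integration.integral_diff; (subst Bochner_Integration.integral_sum)?)
       (auto simp: fmeasurable_def intro!: Bochner_Integration.integrable_sum integrable_real_indicator)
  also have "\<dots> \<le> 0" using full d by (simp add: mult.commute)
  finally have "(\<integral>x. excess x \<partial>lebesgue) = 0"
    using Bochner_Integration.integral_nonneg[of lebesgue excess] nonneg by (simp add: antisym)
  then have zero: "AE x in lebesgue. excess x = 0"
    using integral_nonneg_eq_0_iff_AE[OF int] nonneg by simp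
  show "?B z \<subseteq> I" if z: "z \<in> Z" for z
  proof -
    have "?B z - closure I = {}"
    proof (rule ccontr)
      assume "?B z - closure I \<noteq> {}"
      moreover have "open (?B z - closure I)" by auto
      ultimately obtain x where x: "x \<in> ?B z - closure I" "excess x = 0"
        using AE_lebesgue_open_witness[OF zero] by metis
      then have "x \<notin> I" using closure_subset by auto
      then have "excess x = (\<Sum>z\<in>Z. indicator (?B z) x)" by (simp add: excess_def)
      then show False using x one_le[OF z, of x] by simp
    qed
    then have "?B z \<subseteq> interior (closure I)" by (intro interior_maximal) auto
    then show ?thesis
      using convex_interior_closure[of I] I by (simp add: is_interval_convex_1 interior_open)
  qed
  show "?B z \<inter> ?B z' = {}" if z: "z \<in> Z" "z' \<in> Z" "z \<noteq> z'" for z z'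
  proof (rule ccontr)
    assume "?B z \<inter> ?B z' \<noteq> {}"
    moreover have "open (?B z \<inter> ?B z')" by auto
    ultimately obtain x where x: "x \<in> ?B z \<inter> ?B z'" "excess x = 0"
      using AE_lebesgue_open_witness[OF zero] by metis
    have "(\<Sum>w\<in>{z, z'}. indicator (?B w) x :: real) \<le> (\<Sum>w\<in>Z. indicator (?B w) x)"
      using z Z by (intro sum_mono2) auto
    then have "2 \<le> (\<Sum>w\<in>Z. indicator (?B w) x :: real)" using x(1) z(3) by simp
    then have "1 \<le> excess x" unfolding excess_def by (simp add: indicator_def)
    then show False using x(2) by simp
  qed
qed

text \<open>
  If \<open>f\<close> has the same sign on both sides of \<open>z\<close>, then \<open>z\<close> does not separate anything: a pair of
  opposite signs on different sides of \<open>z\<close> can be replaced by a pair on one side.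
\<close>

lemma separates_removable:
  assumes sep: "separates I Z f" and d: "d > 0" and sub: "{z - d<..<z + d} \<subseteq> I"
    and only: "Z \<inter> {z - d<..<z + d} \<subseteq> {z}" and I: "I \<in> sets lebesgue"
    and s: "s \<noteq> 0"
    and left: "AE x in lebesgue_on I. x \<in> {z - d<..<z} \<longrightarrow> f x = s"
    and right: "AE x in lebesgue_on I. x \<in> {z<..<z + d} \<longrightarrow> f x = s"
  shows "separates I (Z - {z}) f"
proof -
  obtain E where E: "negligible E" and sepE: "\<And>x y. x \<in> I - E \<Longrightarrow> y \<in> I - E \<Longrightarrow> f x > 0 \<Longrightarrow> f y < 0
      \<Longrightarrow> \<exists>z\<in>Z. z \<in> closed_segment x y"
    using sep unfolding separates_def by blast
  have notE: "AE x in lebesgue. x \<notin> E"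
    by (intro AE_not_in) (use E in \<open>simp only: negligible_iff_null_sets\<close>)
  have subI: "{z - d<..<z} \<subseteq> I" "{z<..<z + d} \<subseteq> I"
  proof -
    have "{z - d<..<z} \<subseteq> {z - d<..<z + d}" "{z<..<z + d} \<subseteq> {z - d<..<z + d}" using d by auto
    then show "{z - d<..<z} \<subseteq> I" "{z<..<z + d} \<subseteq> I" using sub by blast+
  qed
  have ae_l: "AE x in lebesgue. x \<notin> E \<and> (x \<in> {z - d<..<z} \<longrightarrow> f x = s)"
    using notE left[unfolded AE_lebesgue_on_iff[OF I]] by eventually_elim (use subI in blast)
  have "open {z - d<..<z}" "{z - d<..<z} \<noteq> {}" using d by auto
  then obtain l where "l \<in> {z - d<..<z}" "l \<notin> E \<and> (l \<in> {z - d<..<z} \<longrightarrow> f l = s)"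
    by (rule AE_lebesgue_open_witness[OF ae_l])
  then have l: "l \<in> {z - d<..<z}" "l \<notin> E" "f l = s" by auto
  have ae_r: "AE x in lebesgue. x \<notin> E \<and> (x \<in> {z<..<z + d} \<longrightarrow> f x = s)"
    using notE right[unfolded AE_lebesgue_on_iff[OF I]] by eventually_elim (use subI in blast)
  have "open {z<..<z + d}" "{z<..<z + d} \<noteq> {}" using d by auto
  then obtain r where "r \<in> {z<..<z + d}" "r \<notin> E \<and> (r \<in> {z<..<z + d} \<longrightarrow> f r = s)"
    by (rule AE_lebesgue_open_witness[OF ae_r])
  then have r: "r \<in> {z<..<z + d}" "r \<notin> E" "f r = s" by auto
  have lr: "l \<in> I" "r \<in> I" using l r sub by auto
  \<comment> \<open>A point \<open>w\<close> where \<open>f\<close> has the sign opposite to \<open>s\<close> is separated by \<open>Z\<close> from the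
    witness \<open>q\<close> that lies on the same side of \<open>z\<close> as \<open>w\<close>, hence by a point other than \<open>z\<close>.\<close>
  have key: "\<exists>z'\<in>Z. z' \<noteq> z \<and> (if w > z then z < z' \<and> z' \<le> w else w \<le> z' \<and> z' < z)"
    if w: "w \<in> I - E" "w \<noteq> z" "f w * s < 0" for w
  proof -
    define q where "q = (if w > z then r else l)"
    have q: "q \<in> I - E" "f q = s" using l r lr by (auto simp: q_def)
    obtain z' where z': "z' \<in> Z" "z' \<in> closed_segment q w"
    proof (cases "s > 0")
      case True
      then have "f w < 0" using w(3) by (simp add: mult_less_0_iff)
      then show ?thesis using sepE[OF q(1) w(1)] q(2) True that by auto
    next
      case False
      then have "s < 0" "f w > 0" using w(3) s by (auto simp: mult_less_0_iff)
      then show ?thesis using sepE[OF w(1) q(1)] q(2) that by (auto simp: closed_segment_commute)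
    qed
    have "z' \<noteq> z" "z < w \<Longrightarrow> z < z' \<and> (z' \<le> w \<or> z' \<in> {z - d<..<z + d})"
      "w < z \<Longrightarrow> z' < z \<and> (w \<le> z' \<or> z' \<in> {z - d<..<z + d})"
      using z'(2) l(1) r(1) w(2) d unfolding q_def
      by (auto simp: closed_segment_eq_real_ivl split: if_splits)
    then show ?thesis using z'(1) only w(2) by (intro bexI[of _ z']) auto
  qed
  show ?thesis
    unfolding separates_def
  proof (intro exI conjI ballI impI)
    show "negligible (insert z E)" using E by simp
    fix x y assume x: "x \<in> I - insert z E" and y: "y \<in> I - insert z E" and pos: "f x > 0" and neg: "f y < 0"
    obtain z0 where z0: "z0 \<in> Z" "z0 \<in> closed_segment x y" using sepE x y pos neg by blast
    show "\<exists>z'\<in>Z - {z}. z' \<in> closed_segment x y"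
    proof (cases "z0 = z")
      case False
      then show ?thesis using z0 by blast
    next
      case True
      then have opp: "(x < z \<and> z < y) \<or> (y < z \<and> z < x)"
        using z0(2) x y by (auto simp: closed_segment_eq_real_ivl split: if_splits)
      define w where "w = (if s > 0 then y else x)"
      have "w \<in> I - E" "w \<noteq> z" "f w * s < 0"
        using x y pos neg s by (auto simp: w_def mult_less_0_iff)
      from key[OF this] obtain z' where "z' \<in> Z" "z' \<noteq> z"
        "if w > z then z < z' \<and> z' \<le> w else w \<le> z' \<and> z' < z" by blast
      then show ?thesis using opp
        by (intro bexI[of _ z']) (auto simp: w_def closed_segment_eq_real_ivl split: if_splits)
    qed
  qed
qed

lemma constant_sign_off_separating_set:
  assumes sep: "separates I Z f" and I: "I \<in> sets lebesgue"
    and sub: "{u<..<v} \<subseteq> I" and none: "Z \<inter> {u<..<v} = {}"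
    and abs: "AE x in lebesgue_on I. x \<in> {u<..<v} \<longrightarrow> \<bar>f x\<bar> = c"
  obtains s where "s = c \<or> s = - c" "AE x in lebesgue_on I. x \<in> {u<..<v} \<longrightarrow> f x = s"
proof -
  obtain E where E: "negligible E" and sepE: "\<And>x y. x \<in> I - E \<Longrightarrow> y \<in> I - E \<Longrightarrow> f x > 0 \<Longrightarrow> f y < 0
      \<Longrightarrow> \<exists>z\<in>Z. z \<in> closed_segment x y"
    using sep unfolding separates_def by blast
  have notE: "AE x in lebesgue_on I. x \<notin> E"
    unfolding AE_lebesgue_on_iff[OF I] using AE_not_in[OF E[unfolded negligible_iff_null_sets]]
    by (auto elim!: eventually_mono)
  show ?thesis
  proof (cases "\<exists>x\<in>{u<..<v} - E. f x > 0")
    case True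
    then obtain x where x: "x \<in> {u<..<v}" "x \<notin> E" "f x > 0" by blast
    have ge: "f y \<ge> 0" if "y \<in> {u<..<v}" "y \<notin> E" for y
    proof (rule ccontr)
      assume "\<not> f y \<ge> 0"
      moreover have "x \<in> I - E" "y \<in> I - E" using x that sub by blast+
      ultimately obtain z where "z \<in> Z" "z \<in> closed_segment x y"
        using sepE[of x y] x(3) by auto
      moreover from this have "z \<in> {u<..<v}"
        using x(1) that(1) by (auto simp: closed_segment_eq_real_ivl split: if_splits)
      ultimately show False using none by blast
    qed
    have "AE x in lebesgue_on I. x \<in> {u<..<v} \<longrightarrow> f x = c"
      using notE abs by eventually_elim (use ge in \<open>auto simp: abs_of_nonneg\<close>)
    then show ?thesis using that by blast
  next
    case False
    have "AE x in lebesgue_on I. x \<in> {u<..<v} \<longrightarrow> f x = - c"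
      using notE abs by eventually_elim (use False in \<open>force simp: not_less abs_of_nonpos\<close>)
    then show ?thesis using that by blast
  qed
qed

lemma AE_lebesgue_on_subset:
  assumes "I \<in> sets lebesgue" "S \<in> sets lebesgue" "S \<subseteq> I"
    and "AE x in lebesgue_on I. x \<in> S \<longrightarrow> Q x"
  shows "AE x in lebesgue_on S. Q x"
  using assms(4) unfolding AE_lebesgue_on_iff[OF assms(1)] AE_lebesgue_on_iff[OF assms(2)]
  by eventually_elim (use assms(3) in auto)

context balanced_function
begin

text \<open>
  If \<open>\<integral> infdist x Z |f|\<close> exceeded its minimum, the first-order term in the cost would be positive by
  the same amount for all couplings, and the infimum over the couplings would be larger too.
\<close>

lemma AE_full_height_of_equality:
  assumes sep: "separates I Z f" and Z: "finite Z" and p: "p \<ge> 1"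
    and le: "W_parts p I f \<le> width (card Z) * mass powr (1 / p)"
  shows "AE x in lebesgue_on I. \<bar>f x\<bar> =
    height * indicator (\<Union>z\<in>Z. {z - width (card Z)<..<z + width (card Z)}) x"
proof -
  let ?d = "width (card Z)" and ?A = "\<integral>x. infdist x Z * \<bar>f x\<bar> \<partial>lebesgue_on I"
  have ne: "Z \<noteq> {}" by (rule separating_set_nonempty[OF sep])
  then have N: "card Z > 0" using Z by (simp add: card_gt_0_iff)
  have d: "?d > 0" by (rule width_pos[OF N])
  have "?A \<le> ?d * mass"
  proof (rule ccontr)
    assume A: "\<not> ?A \<le> ?d * mass"
    have "?d * mass powr (1 / p) = (mass * ?d powr p) powr (1 / p)"
      using cost_root[OF d p] by simp
    also have "\<dots> < (mass * ?d powr p + p * ?d powr (p - 1) * (?A - ?d * mass)) powr (1 / p)"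
    proof (rule powr_less_mono2)
      have "0 < p * ?d powr (p - 1) * (?A - ?d * mass)"
      proof (intro mult_pos_pos)
        show "0 < ?A - ?d * mass" using A by linarith
      qed (use N height_pos mass_pos p in auto)
      then show "mass * ?d powr p < mass * ?d powr p + p * ?d powr (p - 1) * (?A - ?d * mass)"
        by linarith
      show "0 \<le> mass * ?d powr p" using mass_pos by (intro mult_nonneg_nonneg) auto
    qed (use p in auto)
    also have "\<dots> \<le> W_parts p I f" using A by (intro W_parts_ge[OF sep d p]) simp
    finally show False using le by simp
  qed
  then show ?thesis using bathtub_equality[OF Z ne, of ?d] bathtub_width[OF N] d by simp
qed

lemma L1_norm_of_full_height:
  assumes U: "U \<in> sets lebesgue" and f: "AE x in lebesgue_on I. \<bar>f x\<bar> = height * indicator U x"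
  shows "L1_norm I f = height * measure lebesgue (I \<inter> U)"
proof -
  have "L1_norm I f = (\<integral>x. height * indicator U x \<partial>lebesgue_on I)"
    unfolding L1_norm_def using f U
    by (intro integral_cong_AE) (auto intro!: measurable_restrict_space1)
  also have "\<dots> = (\<integral>x. height * indicator (I \<inter> U) x \<partial>lebesgue)"
  proof -
    have "(\<lambda>x. indicator I x *\<^sub>R (height * indicator U x)) = (\<lambda>x. height * indicator (I \<inter> U) x)"
      by (auto simp: fun_eq_iff indicator_def)
    then show ?thesis using I_lebesgue(1) by (subst integral_restrict_space) simp_all
  qed
  also have "\<dots> = height * measure lebesgue (I \<inter> U)" by simp
  finally show ?thesis .
qed

lemma packing_of_full_height:
  assumes Z: "finite Z" "card Z > 0"
    and f: "AE x in lebesgue_on I. \<bar>f x\<bar> =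
      height * indicator (\<Union>z\<in>Z. {z - width (card Z)<..<z + width (card Z)}) x"
  shows "\<And>z. z \<in> Z \<Longrightarrow> {z - width (card Z)<..<z + width (card Z)} \<subseteq> I"
    and "\<And>z z'. z \<in> Z \<Longrightarrow> z' \<in> Z \<Longrightarrow> z \<noteq> z' \<Longrightarrow>
      {z - width (card Z)<..<z + width (card Z)} \<inter> {z' - width (card Z)<..<z' + width (card Z)} = {}"
proof -
  let ?d = "width (card Z)"
  have "(\<Union>z\<in>Z. {z - ?d<..<z + ?d}) \<in> sets lebesgue" using Z by auto
  from L1_norm_of_full_height[OF this f]
  have "measure lebesgue (I \<inter> (\<Union>z\<in>Z. {z - ?d<..<z + ?d})) = L1_norm I f / height"
    using height_pos by (metis less_irrefl nonzero_mult_div_cancel_left)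
  moreover have "2 * ?d * card Z = L1_norm I f / height" using Z(2) by simp
  ultimately have full: "2 * ?d * card Z \<le> measure lebesgue (I \<inter> (\<Union>z\<in>Z. {z - ?d<..<z + ?d}))"
    by simp
  have d: "0 \<le> ?d" using width_pos[OF Z(2)] by simp
  show "\<And>z. z \<in> Z \<Longrightarrow> {z - ?d<..<z + ?d} \<subseteq> I"
    by (rule full_measure_union_packing(1)[OF I_open I_interval Z(1) d full])
  show "\<And>z z'. z \<in> Z \<Longrightarrow> z' \<in> Z \<Longrightarrow> z \<noteq> z' \<Longrightarrow> {z - ?d<..<z + ?d} \<inter> {z' - ?d<..<z' + ?d} = {}"
    by (rule full_measure_union_packing(2)[OF I_open I_interval Z(1) d full])
qed

text \<open>
  What remains to be excluded is that both halves of a ball carry the same sign. In that case the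
  centre could be dropped from \<open>Z\<close>, and the lower bound for fewer points, which is strictly larger,
  would contradict equality.
\<close>

proposition antisymmetric_step_of_equality:
  assumes sep: "separates I Z f" and Z: "finite Z" and p: "p \<ge> 1"
    and le: "W_parts p I f \<le> width (card Z) * mass powr (1 / p)"
  shows "antisymmetric_step I Z height (width (card Z)) f"
proof -
  let ?d = "width (card Z)"
  let ?U = "\<Union>z\<in>Z. {z - ?d<..<z + ?d}"
  have "Z \<noteq> {}" by (rule separating_set_nonempty[OF sep])
  then have N: "card Z > 0" using Z by (simp add: card_gt_0_iff)
  have d: "?d > 0" by (rule width_pos[OF N])
  note full = AE_full_height_of_equality[OF sep Z p le]
  note inside = packing_of_full_height(1)[OF Z N full]
  note disjoint = packing_of_full_height(2)[OF Z N full]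
  have only: "Z \<inter> {z - ?d<..<z + ?d} \<subseteq> {z}" if "z \<in> Z" for z
  proof
    fix z' assume z': "z' \<in> Z \<inter> {z - ?d<..<z + ?d}"
    then have "z' \<in> {z - ?d<..<z + ?d} \<inter> {z' - ?d<..<z' + ?d}" using d by auto
    then show "z' \<in> {z}" using disjoint[OF that, of z'] z' by blast
  qed
  have "{z - ?d<..<z + ?d} \<subseteq> I \<and>
        ((AE x in lebesgue_on {z - ?d<..<z}. f x = height) \<and>
           (AE x in lebesgue_on {z<..<z + ?d}. f x = - height) \<or>
         (AE x in lebesgue_on {z - ?d<..<z}. f x = - height) \<and>
           (AE x in lebesgue_on {z<..<z + ?d}. f x = height))" if z: "z \<in> Z" for z
  proof -
    have halves: "{z - ?d<..<z} \<subseteq> {z - ?d<..<z + ?d}" "{z<..<z + ?d} \<subseteq> {z - ?d<..<z + ?d}"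
      using d by auto
    have subI: "{z - ?d<..<z} \<subseteq> I" "{z<..<z + ?d} \<subseteq> I"
      using halves inside[OF z] by blast+
    have none: "Z \<inter> {z - ?d<..<z} = {}" "Z \<inter> {z<..<z + ?d} = {}"
      using only[OF z] halves by auto
    have abs: "AE x in lebesgue_on I. x \<in> S \<longrightarrow> \<bar>f x\<bar> = height" if "S \<subseteq> {z - ?d<..<z + ?d}" for S
      using full
    proof eventually_elim
      case (elim x)
      show ?case
      proof
        assume "x \<in> S"
        then have mem: "x \<in> ?U" using that z by blast
        show "\<bar>f x\<bar> = height" using elim unfolding indicator_simps(1)[OF mem] by simp
      qed
    qed
    obtain s where s: "s = height \<or> s = - height"
      and left: "AE x in lebesgue_on I. x \<in> {z - ?d<..<z} \<longrightarrow> f x = s"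
      using constant_sign_off_separating_set[OF sep I_lebesgue(1) subI(1) none(1) abs[OF halves(1)]] by blast
    obtain t where t: "t = height \<or> t = - height"
      and right: "AE x in lebesgue_on I. x \<in> {z<..<z + ?d} \<longrightarrow> f x = t"
      using constant_sign_off_separating_set[OF sep I_lebesgue(1) subI(2) none(2) abs[OF halves(2)]] by blast
    have "s \<noteq> t"
    proof
      assume "s = t"
      then have sep': "separates I (Z - {z}) f"
        using separates_removable[OF sep d inside[OF z] only[OF z] I_lebesgue(1) _ left] right s height_pos
        by auto
      have fin': "finite (Z - {z})" using Z by simp
      have N': "card (Z - {z}) > 0"
        using separating_set_nonempty[OF sep'] fin' by (simp add: card_gt_0_iff)
      have "card (Z - {z}) < card Z" using z Z by (intro psubset_card_mono) auto
      then have "?d < width (card (Z - {z}))"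
        using N' height_pos mass_pos by (intro divide_strict_left_mono) auto
      then have "?d * mass powr (1 / p) < width (card (Z - {z})) * mass powr (1 / p)"
        using mass_pos by (intro mult_strict_right_mono) auto
      also have "\<dots> \<le> W_parts p I f" by (rule W_parts_ge_width[OF sep' fin' p])
      finally show False using le by simp
    qed
    then have "s = - t" and "t = - s" using s t by auto
    moreover have "AE x in lebesgue_on {z - ?d<..<z}. f x = s"
      by (rule AE_lebesgue_on_subset[OF I_lebesgue(1) _ subI(1) left]) simp
    moreover have "AE x in lebesgue_on {z<..<z + ?d}. f x = t"
      by (rule AE_lebesgue_on_subset[OF I_lebesgue(1) _ subI(2) right]) simp
    ultimately show ?thesis using s inside[OF z] by (elim disjE) simp_all
  qed
  moreover have "AE x in lebesgue_on (I - ?U). f x = 0"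
  proof (rule AE_lebesgue_on_subset[of I])
    show "AE x in lebesgue_on I. x \<in> I - ?U \<longrightarrow> f x = 0"
      using full by eventually_elim auto
    show "I - ?U \<in> sets lebesgue" using I_lebesgue Z by (intro sets.Diff sets.finite_UN) auto
  qed (use I_lebesgue in auto)
  ultimately show ?thesis by (simp add: antisymmetric_step_def)
qed

end

section \<open>The transport cost of an antisymmetric step function\<close>

text \<open>
  Here \<open>u z\<close> and \<open>v z\<close> are the left end points of the positive and the negative half of the ball
  around \<open>z\<close>.
\<close>

lemma antisymmetric_step_parts:
  assumes step: "antisymmetric_step I Z c d f" and I: "I \<in> sets lebesgue"
    and Z: "finite Z" and c: "c > 0" and d: "d > 0"
    and disjoint: "\<And>z z'. z \<in> Z \<Longrightarrow> z' \<in> Z \<Longrightarrow> z \<noteq> z' \<Longrightarrow> {z - d<..<z + d} \<inter> {z' - d<..<z' + d} = {}"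
  obtains u v where "\<And>z. z \<in> Z \<Longrightarrow> (u z, v z) \<in> {(z - d, z), (z, z - d)}"
    and "AE x in lebesgue_on I. f_plus f x = c * (\<Sum>z\<in>Z. indicator {u z<..<u z + d} x)
           \<and> f_minus f x = - (c * (\<Sum>z\<in>Z. indicator {v z<..<v z + d} x))"
proof -
  let ?B = "\<lambda>z. {z - d<..<z + d}"
  let ?up = "\<lambda>z. AE x in lebesgue_on {z - d<..<z}. f x = c"
  define u v where "u z = (if ?up z then z - d else z)" and "v z = (if ?up z then z else z - d)" for z
  have uv: "(u z, v z) \<in> {(z - d, z), (z, z - d)}" for z by (auto simp: u_def v_def)
  have halves: "AE x in lebesgue. \<forall>z\<in>Z. (x \<in> {u z<..<u z + d} \<longrightarrow> f x = c) \<and> (x \<in> {v z<..<v z + d} \<longrightarrow> f x = - c)"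
  proof (subst AE_finite_all[OF Z], rule ballI)
    fix z assume "z \<in> Z"
    then have "(AE x in lebesgue_on {z - d<..<z}. f x = c) \<and> (AE x in lebesgue_on {z<..<z + d}. f x = - c) \<or>
      \<not> ?up z \<and> (AE x in lebesgue_on {z - d<..<z}. f x = - c) \<and> (AE x in lebesgue_on {z<..<z + d}. f x = c)"
    proof -
      have excl: "\<not> ((AE x in lebesgue_on {z - d<..<z}. f x = c) \<and> (AE x in lebesgue_on {z - d<..<z}. f x = - c))"
      proof
        assume "(AE x in lebesgue_on {z - d<..<z}. f x = c) \<and> (AE x in lebesgue_on {z - d<..<z}. f x = - c)"
        then have "AE x in lebesgue_on {z - d<..<z}. f x = c" "AE x in lebesgue_on {z - d<..<z}. f x = - c" by auto
        then have "AE x in lebesgue_on {z - d<..<z}. False"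
          by eventually_elim (use c in auto)
        then have ae: "AE x in lebesgue. x \<notin> {z - d<..<z}"
          by (simp add: AE_lebesgue_on_iff)
        have "open {z - d<..<z}" "{z - d<..<z} \<noteq> {}" using d by auto
        then show False using AE_lebesgue_open_witness[OF ae] by blast
      qed
      show ?thesis using step \<open>z \<in> Z\<close> excl unfolding antisymmetric_step_def by blast
    qed
    then show "AE x in lebesgue. (x \<in> {u z<..<u z + d} \<longrightarrow> f x = c) \<and> (x \<in> {v z<..<v z + d} \<longrightarrow> f x = - c)"
      by (auto simp: AE_lebesgue_on_iff u_def v_def)
  qed
  have "I - (\<Union>z\<in>Z. ?B z) \<in> sets lebesgue" using I Z by (intro sets.Diff sets.finite_UN) auto
  then have outside: "AE x in lebesgue. x \<in> I - (\<Union>z\<in>Z. ?B z) \<longrightarrow> f x = 0"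
    using step unfolding antisymmetric_step_def by (simp only: AE_lebesgue_on_iff)
  have centres: "AE x in lebesgue. x \<notin> Z"
    by (intro AE_not_in) (use Z negligible_finite[of Z] in \<open>simp only: negligible_iff_null_sets\<close>)
  have "AE x in lebesgue. x \<in> I \<longrightarrow> f_plus f x = c * (\<Sum>z\<in>Z. indicator {u z<..<u z + d} x)
           \<and> f_minus f x = - (c * (\<Sum>z\<in>Z. indicator {v z<..<v z + d} x))"
    using halves outside centres
  proof eventually_elim
    case (elim x)
    have in_ball: "x \<in> ?B z" if "z \<in> Z" "x \<in> {u z<..<u z + d} \<or> x \<in> {v z<..<v z + d}" for z
      using that uv[of z] d by auto
    show ?case
    proof (cases "x \<in> (\<Union>z\<in>Z. ?B z)")
      case True
      then obtain z where z: "z \<in> Z" "x \<in> ?B z" by blast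
      have others: "x \<notin> {u w<..<u w + d}" "x \<notin> {v w<..<v w + d}" if "w \<in> Z - {z}" for w
        using in_ball[of w] disjoint[of z w] that z by blast+
      have "(\<Sum>w\<in>Z. indicator {u w<..<u w + d} x) = (indicator {u z<..<u z + d} x :: real)"
        "(\<Sum>w\<in>Z. indicator {v w<..<v w + d} x) = (indicator {v z<..<v z + d} x :: real)"
        using others by (simp_all add: sum.remove[OF Z z(1)])
      moreover have "x \<noteq> z" using z elim by auto
      then have "x \<in> {u z<..<u z + d} \<and> x \<notin> {v z<..<v z + d} \<or> x \<notin> {u z<..<u z + d} \<and> x \<in> {v z<..<v z + d}"
        using uv[of z] z(2) by auto
      ultimately show ?thesis using elim(1) z(1) c by (auto simp: f_plus_def f_minus_def)
    next
      case False
      then have "x \<notin> {u w<..<u w + d}" "x \<notin> {v w<..<v w + d}" if "w \<in> Z" for w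
        using in_ball[OF that] that by blast+
      then have "(\<Sum>w\<in>Z. indicator {u w<..<u w + d} x) = (0 :: real)"
        "(\<Sum>w\<in>Z. indicator {v w<..<v w + d} x) = (0 :: real)"
        by (simp_all add: sum.neutral)
      then show ?thesis using elim(2) False by (auto simp: f_plus_def f_minus_def)
    qed
  qed
  then have "AE x in lebesgue_on I. f_plus f x = c * (\<Sum>z\<in>Z. indicator {u z<..<u z + d} x)
           \<and> f_minus f x = - (c * (\<Sum>z\<in>Z. indicator {v z<..<v z + d} x))"
    using AE_lebesgue_on_iff[OF I] by blast
  with uv show ?thesis using that by blast
qed

lemma emeasure_lborel_translate:
  fixes a :: real
  assumes "A \<in> sets borel"
  shows "emeasure lborel {t. a + t \<in> A} = emeasure lborel A"
proof -
  have "emeasure lborel A = emeasure (distr lborel borel ((+) a)) A"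
    by (simp add: lborel_distr_plus)
  also have "\<dots> = emeasure lborel {t. a + t \<in> A}"
    using assms by (subst emeasure_distr) (auto simp: vimage_def)
  finally show ?thesis by simp
qed

lemma emeasure_mass_measure_step:
  assumes I: "I \<in> sets borel" and g: "g \<in> borel_measurable (lebesgue_on I)" and Z: "finite Z" and c: "c \<ge> 0"
    and g_eq: "AE x in lebesgue_on I. \<bar>g x\<bar> = c * (\<Sum>z\<in>Z. indicator {u z<..<u z + d} x)"
    and A: "A \<in> sets (restrict_space borel I)"
  shows "emeasure (mass_measure I g) A
    = (\<Sum>z\<in>Z. ennreal c * emeasure lborel {t \<in> {0<..<d}. u z + t \<in> A})"
proof -
  have I': "I \<in> sets lebesgue" using I by simp
  obtain A' where "A' \<in> sets borel" "A = I \<inter> A'"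
    using A unfolding sets_restrict_space by blast
  then have A_borel: "A \<in> sets borel" and "A \<subseteq> I" using I by auto
  have "emeasure (mass_measure I g) A = (\<integral>\<^sup>+x. ennreal \<bar>g x\<bar> * indicator A x \<partial>lebesgue_on I)"
    by (rule emeasure_mass_measure[OF I' g A])
  also have "\<dots> = (\<integral>\<^sup>+x. (\<Sum>z\<in>Z. ennreal c * indicator (A \<inter> {u z<..<u z + d}) x) \<partial>lebesgue_on I)"
  proof (rule nn_integral_cong_AE)
    show "AE x in lebesgue_on I. ennreal \<bar>g x\<bar> * indicator A x
        = (\<Sum>z\<in>Z. ennreal c * indicator (A \<inter> {u z<..<u z + d}) x)"
      using g_eq
    proof eventually_elim
      case (elim x)
      have "ennreal \<bar>g x\<bar> = ennreal c * (\<Sum>z\<in>Z. indicator {u z<..<u z + d} x)"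
        unfolding elim using c
        by (simp add: ennreal_mult sum_nonneg ennreal_indicator flip: sum_ennreal)
      then show ?case
        by (simp add: sum_distrib_left indicator_inter_arith mult_ac)
    qed
  qed
  also have "\<dots> = (\<Sum>z\<in>Z. ennreal c * emeasure (lebesgue_on I) (A \<inter> {u z<..<u z + d}))"
  proof -
    have "A \<inter> {u z<..<u z + d} \<in> sets (lebesgue_on I)" for z
      using A_borel \<open>A \<subseteq> I\<close> I' by (auto simp: sets_restrict_space_iff)
    then show ?thesis by (subst nn_integral_sum) (auto simp: nn_integral_cmult_indicator)
  qed
  also have "\<dots> = (\<Sum>z\<in>Z. ennreal c * emeasure lborel {t \<in> {0<..<d}. u z + t \<in> A})"
  proof (rule sum.cong[OF refl])
    fix z
    have "emeasure (lebesgue_on I) (A \<inter> {u z<..<u z + d}) = emeasure lborel (A \<inter> {u z<..<u z + d})"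
      using A_borel \<open>A \<subseteq> I\<close> I' by (subst emeasure_restrict_space) (auto simp: emeasure_completion)
    also have "\<dots> = emeasure lborel {t. u z + t \<in> A \<inter> {u z<..<u z + d}}"
      using A_borel by (intro emeasure_lborel_translate[symmetric]) auto
    also have "{t. u z + t \<in> A \<inter> {u z<..<u z + d}} = {t \<in> {0<..<d}. u z + t \<in> A}" by auto
    finally show "ennreal c * emeasure (lebesgue_on I) (A \<inter> {u z<..<u z + d})
      = ennreal c * emeasure lborel {t \<in> {0<..<d}. u z + t \<in> A}" by simp
  qed
  finally show ?thesis .
qed

text \<open>
  The coupling is the image of \<open>c\<close> times the product of counting measure on \<open>Z\<close> and Lebesgue measure
  on \<open>(0, d)\<close> under \<open>(z, t) \<mapsto> (u z + t, v z + t)\<close>. Both marginals then have the same form and are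
  computed by one argument, and the distance between the two components is constant.
\<close>

lemma translation_coupling:
  fixes Z :: "real set" and u v :: "real \<Rightarrow> real"
  assumes I: "I \<in> sets borel" and Z: "finite Z" and c: "c \<ge> 0" and d: "d \<ge> 0"
    and u: "\<And>z. z \<in> Z \<Longrightarrow> {u z<..<u z + d} \<subseteq> I" and v: "\<And>z. z \<in> Z \<Longrightarrow> {v z<..<v z + d} \<subseteq> I"
    and shift: "\<And>z. z \<in> Z \<Longrightarrow> \<bar>u z - v z\<bar> = d"
    and g: "g \<in> borel_measurable (lebesgue_on I)"
      "AE x in lebesgue_on I. \<bar>g x\<bar> = c * (\<Sum>z\<in>Z. indicator {u z<..<u z + d} x)"
    and h: "h \<in> borel_measurable (lebesgue_on I)"
      "AE x in lebesgue_on I. \<bar>h x\<bar> = c * (\<Sum>z\<in>Z. indicator {v z<..<v z + d} x)"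
  obtains \<gamma> where "\<gamma> \<in> couplings (mass_measure I g) (mass_measure I h)"
    and "(\<integral>(x, y). \<bar>x - y\<bar> powr p \<partial>\<gamma>) = d powr p * measure (mass_measure I g) I"
proof -
  let ?M = "mass_measure I g" and ?N = "mass_measure I h"
  define T where "T = (restrict_space lborel {0<..<d} :: real measure)"
  define K where "K = scale_measure (ennreal c) (count_space Z \<Otimes>\<^sub>M T)"
  have sets_T: "sets T = sets (restrict_space borel {0<..<d})"
    by (simp add: T_def sets_restrict_space)
  have space_T: "space T = {0<..<d}" by (simp add: T_def space_restrict_space)
  have "emeasure T (space T) \<noteq> \<infinity>"
    using d by (simp add: space_T T_def emeasure_restrict_space)
  then interpret T: finite_measure T by (rule finite_measureI)
  have sets_K: "sets K = sets (count_space Z \<Otimes>\<^sub>M T)" and space_K: "space K = Z \<times> {0<..<d}"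
    by (simp_all add: K_def space_scale_measure space_pair_measure space_T)
  have move: "(\<lambda>(z, t). w z + t) \<in> K \<rightarrow>\<^sub>M mass_measure I k"
    if w: "\<And>z. z \<in> Z \<Longrightarrow> {w z<..<w z + d} \<subseteq> I" for w k
  proof -
    have "(\<lambda>(z, t). w z + t) \<in> count_space Z \<Otimes>\<^sub>M T \<rightarrow>\<^sub>M restrict_space borel I"
    proof (rule measurable_pair_measure_countable1)
      show "countable Z" using Z by (rule countable_finite)
      show "(\<lambda>t. case (z, t) of (z, t) \<Rightarrow> w z + t) \<in> T \<rightarrow>\<^sub>M restrict_space borel I" if "z \<in> Z" for z
        unfolding T_def split using w[OF that] by (intro measurable_restrict_space3) (auto simp: subset_iff)
    qed
    then show ?thesis using measurable_cong_sets[OF sets_K[symmetric] sets_mass_measure[symmetric]] by blast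
  qed
  have marginal: "distr K (mass_measure I k) (\<lambda>(z, t). w z + t) = mass_measure I k"
    if w: "\<And>z. z \<in> Z \<Longrightarrow> {w z<..<w z + d} \<subseteq> I" and k: "k \<in> borel_measurable (lebesgue_on I)"
      "AE x in lebesgue_on I. \<bar>k x\<bar> = c * (\<Sum>z\<in>Z. indicator {w z<..<w z + d} x)" for w k
  proof (rule measure_eqI)
    fix A assume "A \<in> sets (distr K (mass_measure I k) (\<lambda>(z, t). w z + t))"
    then have A: "A \<in> sets (mass_measure I k)" by simp
    let ?X = "(\<lambda>(z, t). w z + t) -` A \<inter> space K"
    have X: "?X \<in> sets (count_space Z \<Otimes>\<^sub>M T)"
      using measurable_sets[OF move[OF w] A] sets_K by simp
    have "emeasure (distr K (mass_measure I k) (\<lambda>(z, t). w z + t)) A = emeasure K ?X"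
      by (rule emeasure_distr[OF move[OF w] A])
    also have "\<dots> = ennreal c * (\<integral>\<^sup>+z. emeasure T (Pair z -` ?X) \<partial>count_space Z)"
      using T.emeasure_pair_measure_alt[OF X] by (simp add: K_def)
    also have "\<dots> = ennreal c * (\<Sum>z\<in>Z. emeasure T (Pair z -` ?X))"
      using Z by (simp add: nn_integral_count_space_finite)
    also have "\<dots> = (\<Sum>z\<in>Z. ennreal c * emeasure lborel {t \<in> {0<..<d}. w z + t \<in> A})"
      unfolding sum_distrib_left
    proof (rule sum.cong[OF refl])
      fix z assume "z \<in> Z"
      then have "Pair z -` ?X = {t \<in> {0<..<d}. w z + t \<in> A}" by (auto simp: space_K)
      then show "ennreal c * emeasure T (Pair z -` ?X) = ennreal c * emeasure lborel {t \<in> {0<..<d}. w z + t \<in> A}"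
        unfolding T_def by (subst emeasure_restrict_space) auto
    qed
    also have "\<dots> = emeasure (mass_measure I k) A"
      using emeasure_mass_measure_step[OF I k(1) Z c k(2)] A by simp
    finally show "emeasure (distr K (mass_measure I k) (\<lambda>(z, t). w z + t)) A = emeasure (mass_measure I k) A" .
  qed simp
  let ?pair = "\<lambda>(z, t). (u z + t, v z + t)"
  define \<gamma> where "\<gamma> = distr K (?M \<Otimes>\<^sub>M ?N) ?pair"
  have pair: "?pair \<in> K \<rightarrow>\<^sub>M ?M \<Otimes>\<^sub>M ?N"
    using measurable_Pair[OF move[OF u] move[OF v]] by (simp add: case_prod_unfold)
  have fst_\<gamma>: "distr \<gamma> ?M fst = ?M"
    using marginal[OF u g] pair unfolding \<gamma>_def
    by (subst distr_distr) (auto simp: comp_def case_prod_unfold)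
  moreover have "distr \<gamma> ?N snd = ?N"
    using marginal[OF v h] pair unfolding \<gamma>_def
    by (subst distr_distr) (auto simp: comp_def case_prod_unfold)
  ultimately have \<gamma>: "\<gamma> \<in> couplings ?M ?N" by (simp add: couplings_def \<gamma>_def)
  have total: "measure ?M I = measure K (space K)"
  proof -
    have "emeasure ?M I = emeasure (distr K ?M (\<lambda>(z, t). u z + t)) (space ?M)"
      using marginal[OF u g] by simp
    also have "\<dots> = emeasure K (space K)"
    proof -
      have move_u: "(\<lambda>(z, t). u z + t) \<in> K \<rightarrow>\<^sub>M ?M" by (rule move) (use u in auto)
      then have "(\<lambda>(z, t). u z + t) -` space ?M \<inter> space K = space K"
        using measurable_space[OF move_u] by blast
      then show ?thesis by (simp only: emeasure_distr[OF move_u sets.top])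
    qed
    finally show ?thesis by (simp add: measure_def)
  qed
  have id_borel: "(\<lambda>x. x) \<in> borel_measurable (mass_measure I k)" for k
    by (subst measurable_cong_sets[OF sets_mass_measure refl]) (simp add: measurable_restrict_space1)
  have "fst \<in> borel_measurable (?M \<Otimes>\<^sub>M ?N)" "snd \<in> borel_measurable (?M \<Otimes>\<^sub>M ?N)"
    using measurable_compose[OF measurable_fst id_borel] measurable_compose[OF measurable_snd id_borel] by auto
  moreover have "(\<lambda>w. \<bar>a w - b w\<bar> powr p) \<in> borel_measurable X"
    if "a \<in> borel_measurable X" "b \<in> borel_measurable X" for a b :: "real \<times> real \<Rightarrow> real" and X
    using that by measurable
  ultimately have cost: "(\<lambda>w. \<bar>fst w - snd w\<bar> powr p) \<in> borel_measurable (?M \<Otimes>\<^sub>M ?N)"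
    by blast
  have "(\<integral>(x, y). \<bar>x - y\<bar> powr p \<partial>\<gamma>) = (\<integral>w. \<bar>fst (?pair w) - snd (?pair w)\<bar> powr p \<partial>K)"
    using integral_distr[OF pair cost] unfolding \<gamma>_def by (simp only: case_prod_unfold)
  also have "\<dots> = (\<integral>w. d powr p \<partial>K)"
    using shift by (intro Bochner_Integration.integral_cong) (auto simp: space_K)
  also have "\<dots> = d powr p * measure ?M I" by (simp add: total mult.commute)
  finally show ?thesis using that[OF \<gamma>] by blast
qed

context balanced_function
begin

text \<open>
  The prescribed width makes the total mass match only if the balls do not overlap, so their
  disjointness need not be assumed; then the translation between the two halves of each ball is a
  coupling.
\<close>

proposition W_parts_antisymmetric_step:
  assumes step: "antisymmetric_step I Z height (width (card Z)) f" and Z: "finite Z" "card Z > 0"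
  shows "W_parts p I f \<le> (mass * width (card Z) powr p) powr (1 / p)"
proof -
  let ?d = "width (card Z)"
  let ?U = "\<Union>z\<in>Z. {z - ?d<..<z + ?d}"
  have d: "?d > 0" by (rule width_pos[OF Z(2)])
  have full: "AE x in lebesgue_on I. \<bar>f x\<bar> = height * indicator ?U x"
  proof -
    have "AE x in lebesgue. \<forall>z\<in>Z. x \<in> {z - ?d<..<z + ?d} \<longrightarrow> x \<noteq> z \<longrightarrow> \<bar>f x\<bar> = height"
    proof (subst AE_finite_all[OF Z(1)], rule ballI)
      fix z assume "z \<in> Z"
      then have "(AE x in lebesgue_on {z - ?d<..<z}. \<bar>f x\<bar> = height) \<and> (AE x in lebesgue_on {z<..<z + ?d}. \<bar>f x\<bar> = height)"
        using step height_pos unfolding antisymmetric_step_def by (fastforce elim: eventually_mono)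
      then have "AE x in lebesgue. x \<in> {z - ?d<..<z} \<longrightarrow> \<bar>f x\<bar> = height" "AE x in lebesgue. x \<in> {z<..<z + ?d} \<longrightarrow> \<bar>f x\<bar> = height"
        by (auto simp: AE_lebesgue_on_iff)
      then show "AE x in lebesgue. x \<in> {z - ?d<..<z + ?d} \<longrightarrow> x \<noteq> z \<longrightarrow> \<bar>f x\<bar> = height"
        by eventually_elim auto
    qed
    moreover have "AE x in lebesgue. x \<notin> Z"
      by (intro AE_not_in) (use negligible_finite[OF Z(1)] in \<open>simp only: negligible_iff_null_sets\<close>)
    moreover have "AE x in lebesgue. x \<in> I - ?U \<longrightarrow> f x = 0"
    proof -
      have "I - ?U \<in> sets lebesgue" using I_lebesgue Z by (intro sets.Diff sets.finite_UN) auto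
      then show ?thesis using step unfolding antisymmetric_step_def by (simp only: AE_lebesgue_on_iff)
    qed
    ultimately have "AE x in lebesgue. x \<in> I \<longrightarrow> \<bar>f x\<bar> = height * indicator ?U x"
    proof eventually_elim
      case (elim x)
      show ?case
      proof (cases "x \<in> ?U")
        case True
        then have "\<bar>f x\<bar> = height" using elim by blast
        then show ?thesis unfolding indicator_simps(1)[OF True] by simp
      next
        case False
        then show ?thesis using elim(3) unfolding indicator_simps(2)[OF False] by simp
      qed
    qed
    then show ?thesis using AE_lebesgue_on_iff[OF I_lebesgue(1)] by blast
  qed
  note inside = packing_of_full_height(1)[OF Z full]
  note disjoint = packing_of_full_height(2)[OF Z full]
  obtain u v where uv: "\<And>z. z \<in> Z \<Longrightarrow> (u z, v z) \<in> {(z - ?d, z), (z, z - ?d)}"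
    and parts: "AE x in lebesgue_on I. f_plus f x = height * (\<Sum>z\<in>Z. indicator {u z<..<u z + ?d} x)
           \<and> f_minus f x = - (height * (\<Sum>z\<in>Z. indicator {v z<..<v z + ?d} x))"
    using antisymmetric_step_parts[OF step I_lebesgue(1) Z(1) height_pos d disjoint] by blast
  have shift: "\<bar>u z - v z\<bar> = ?d" if "z \<in> Z" for z
  proof -
    have "\<bar>u z - v z\<bar> = \<bar>?d\<bar>" using uv[OF that] by auto
    then show ?thesis using abs_of_pos[OF d] by simp
  qed
  have subs: "{u z<..<u z + ?d} \<subseteq> I" "{v z<..<v z + ?d} \<subseteq> I" if "z \<in> Z" for z
  proof -
    have "{u z<..<u z + ?d} \<subseteq> {z - ?d<..<z + ?d}" "{v z<..<v z + ?d} \<subseteq> {z - ?d<..<z + ?d}"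
      using uv[OF that] d by auto
    then show "{u z<..<u z + ?d} \<subseteq> I" "{v z<..<v z + ?d} \<subseteq> I" using inside[OF that] by blast+
  qed
  have plus: "AE x in lebesgue_on I. \<bar>f_plus f x\<bar> = height * (\<Sum>z\<in>Z. indicator {u z<..<u z + ?d} x)"
    using parts by eventually_elim (use height_pos in \<open>simp add: sum_nonneg abs_mult\<close>)
  have minus: "AE x in lebesgue_on I. \<bar>f_minus f x\<bar> = height * (\<Sum>z\<in>Z. indicator {v z<..<v z + ?d} x)"
    using parts by eventually_elim (use height_pos in \<open>simp add: sum_nonneg abs_mult\<close>)
  obtain \<gamma> where \<gamma>: "\<gamma> \<in> couplings (mass_measure I (f_plus f)) (mass_measure I (f_minus f))"
    and cost: "(\<integral>(x, y). \<bar>x - y\<bar> powr p \<partial>\<gamma>) = ?d powr p * measure (mass_measure I (f_plus f)) I"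
    using translation_coupling[OF I_lebesgue(2) Z(1) height_nonneg less_imp_le[OF d] subs shift
      f_plus_measurable plus f_minus_measurable minus] by metis
  have total: "measure (mass_measure I (f_plus f)) I = mass"
    using emeasure_parts(1) mass_pos by (simp add: measure_def)
  show ?thesis
    using wasserstein_le[OF \<gamma>, of p] unfolding cost total W_parts_def by (simp only: mult.commute)
qed

end

section \<open>A minimizer for every number of nodes\<close>

lemma Linf_enorm_eqI:
  assumes I: "I \<in> sets lebesgue" and f: "f \<in> borel_measurable (lebesgue_on I)"
    and le: "\<And>x. x \<in> I \<Longrightarrow> \<bar>f x\<bar> \<le> c"
    and S: "open S" "S \<noteq> {}" "S \<subseteq> I" "\<And>x. x \<in> S \<Longrightarrow> \<bar>f x\<bar> = c"
  shows "Linf_enorm I f = ereal c"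
proof (rule antisym)
  show "Linf_enorm I f \<le> ereal c"
    unfolding Linf_enorm_def using f le by (intro esssup_I) (auto intro!: AE_I2)
  have "AE x in lebesgue_on I. ereal \<bar>f x\<bar> \<le> Linf_enorm I f"
    unfolding Linf_enorm_def by (rule esssup_AE)
  then have ae: "AE x in lebesgue. x \<in> I \<longrightarrow> ereal \<bar>f x\<bar> \<le> Linf_enorm I f"
    by (simp only: AE_lebesgue_on_iff[OF I])
  obtain x where "x \<in> S" "x \<in> I \<longrightarrow> ereal \<bar>f x\<bar> \<le> Linf_enorm I f"
    by (rule AE_lebesgue_open_witness[OF ae S(1,2)])
  then show "ereal c \<le> Linf_enorm I f" using S(3,4) by auto
qed

text \<open>
  A square wave of period \<open>4 * d\<close> with jumps at the odd multiples of \<open>d\<close>, cut off at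
  \<open>2 * d * N\<close>. Neighbouring balls around the jumps are traversed with opposite orientation, so the sign
  does not change at the even multiples of \<open>d\<close>. The function does not vanish before the cut-off;
  thus its zero set is an interval at the right end of \<open>I\<close> and no jump is counted by a zero component.
\<close>

definition zigzag :: "real \<Rightarrow> real \<Rightarrow> nat \<Rightarrow> real \<Rightarrow> real" where
  "zigzag c d N x =
     (if x < 2 * d * N then (if even \<lfloor>(x + d) / (2 * d)\<rfloor> then c else - c) else 0)"

definition zigzag_nodes :: "real \<Rightarrow> nat \<Rightarrow> real set" where
  "zigzag_nodes d N = (\<lambda>i. (2 * real i + 1) * d) ` {..<N}"

lemma card_zigzag_nodes: "d > 0 \<Longrightarrow> card (zigzag_nodes d N) = N"
  unfolding zigzag_nodes_def by (subst card_image) (auto simp: inj_on_def)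

lemma zigzag_on_cell:
  assumes "d > 0" "(2 * real i - 1) * d \<le> x" "x < (2 * real i + 1) * d" "x < 2 * d * N"
  shows "zigzag c d N x = (if even i then c else - c)"
proof -
  have "\<lfloor>(x + d) / (2 * d)\<rfloor> = int i"
    using assms by (intro floor_unique) (auto simp: field_simps)
  then show ?thesis using assms(4) by (simp add: zigzag_def)
qed

lemma zigzag_zero: "x \<ge> 2 * d * N \<Longrightarrow> zigzag c d N x = 0"
  by (simp add: zigzag_def)

lemma abs_zigzag: "c > 0 \<Longrightarrow> \<bar>zigzag c d N x\<bar> = (if x < 2 * d * N then c else 0)"
  by (simp add: zigzag_def)

lemma zigzag_measurable: "zigzag c d N \<in> borel_measurable (lebesgue_on I)"
proof -
  have "zigzag c d N \<in> borel_measurable borel"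
    unfolding zigzag_def[abs_def] by measurable
  then show ?thesis by (intro measurable_restrict_space1 measurable_completion) simp
qed

lemma zigzag_ball_subset:
  assumes d: "d > 0" and z: "z \<in> zigzag_nodes d N"
  shows "{z - d<..<z + d} \<subseteq> {0<..<2 * d * N}"
proof -
  obtain i where i: "i < N" "z = (2 * real i + 1) * d" using z by (auto simp: zigzag_nodes_def)
  have "0 \<le> 2 * real i * d" "(2 * real i + 2) * d \<le> 2 * real N * d"
    using i(1) d by (auto intro!: mult_right_mono)
  then have "0 \<le> z - d" "z + d \<le> 2 * d * N" using i(2) by (simp_all add: algebra_simps)
  then show ?thesis by auto
qed

lemma zigzag_balls_disjoint:
  assumes d: "d > 0" and z: "z \<in> zigzag_nodes d N" "z' \<in> zigzag_nodes d N" "z \<noteq> z'"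
  shows "{z - d<..<z + d} \<inter> {z' - d<..<z' + d} = {}"
proof -
  have apart: "z + d \<le> z' - d" if "z = (2 * real i + 1) * d" "z' = (2 * real j + 1) * d" "i < j" for z z' i j
  proof -
    have "(real i + 1) * d \<le> real j * d" using that(3) d by (intro mult_right_mono) auto
    then show ?thesis using that by (simp add: algebra_simps)
  qed
  obtain i j where ij: "z = (2 * real i + 1) * d" "z' = (2 * real j + 1) * d"
    using z by (auto simp: zigzag_nodes_def)
  then consider "i < j" | "j < i" using z(3) by (metis nat_neq_iff)
  then show ?thesis using apart[OF ij] apart[OF ij(2,1)] by cases auto
qed

lemma zigzag_antisymmetric_step:
  assumes c: "c > 0" and d: "d > 0" and I: "I = {0<..<L}" and L: "2 * d * N \<le> L"
  shows "antisymmetric_step I (zigzag_nodes d N) c d (zigzag c d N)"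
proof -
  have "{z - d<..<z + d} \<subseteq> I \<and>
        ((AE x in lebesgue_on {z - d<..<z}. zigzag c d N x = c) \<and>
           (AE x in lebesgue_on {z<..<z + d}. zigzag c d N x = - c) \<or>
         (AE x in lebesgue_on {z - d<..<z}. zigzag c d N x = - c) \<and>
           (AE x in lebesgue_on {z<..<z + d}. zigzag c d N x = c))"
    if z: "z \<in> zigzag_nodes d N" for z
  proof -
    obtain i where i: "i < N" "z = (2 * real i + 1) * d" using z by (auto simp: zigzag_nodes_def)
    note ball = zigzag_ball_subset[OF d z]
    have left: "zigzag c d N x = (if even i then c else - c)" if "x \<in> {z - d<..<z}" for x
    proof (rule zigzag_on_cell[OF d])
      show "(2 * real i - 1) * d \<le> x" "x < (2 * real i + 1) * d"
        using that i(2) d by (auto simp: algebra_simps)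
      have "x \<in> {z - d<..<z + d}" using that d by auto
      then show "x < 2 * d * N" using ball by auto
    qed
    have right: "zigzag c d N x = (if even i then - c else c)" if "x \<in> {z<..<z + d}" for x
    proof -
      have "zigzag c d N x = (if even (Suc i) then c else - c)"
      proof (rule zigzag_on_cell[OF d])
        show "(2 * real (Suc i) - 1) * d \<le> x" "x < (2 * real (Suc i) + 1) * d"
          using that i(2) d by (auto simp: algebra_simps)
        have "x \<in> {z - d<..<z + d}" using that d by auto
      then show "x < 2 * d * N" using ball by auto
      qed
      then show ?thesis by simp
    qed
    have "{z - d<..<z + d} \<subseteq> I" using ball I L by auto
    moreover have "AE x in lebesgue_on {z - d<..<z}. zigzag c d N x = (if even i then c else - c)"
      "AE x in lebesgue_on {z<..<z + d}. zigzag c d N x = (if even i then - c else c)"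
      using left right by (auto intro!: AE_I2)
    ultimately show ?thesis by (cases "even i") simp_all
  qed
  moreover have "AE x in lebesgue_on (I - (\<Union>z\<in>zigzag_nodes d N. {z - d<..<z + d})). zigzag c d N x = 0"
  proof -
    let ?E = "(\<lambda>i. 2 * real i * d) ` {..N}"
    have "I - (\<Union>z\<in>zigzag_nodes d N. {z - d<..<z + d}) \<in> sets lebesgue"
      using I by (intro sets.Diff sets.finite_UN) (auto simp: zigzag_nodes_def)
    moreover have "AE x in lebesgue. x \<notin> ?E"
      by (intro AE_not_in) (use negligible_finite[of ?E] in \<open>simp only: negligible_iff_null_sets finite_imageI finite_atMost\<close>)
    then have "AE x in lebesgue. x \<in> I - (\<Union>z\<in>zigzag_nodes d N. {z - d<..<z + d}) \<longrightarrow> zigzag c d N x = 0"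
    proof eventually_elim
      case (elim x)
      show ?case
      proof
        assume x: "x \<in> I - (\<Union>z\<in>zigzag_nodes d N. {z - d<..<z + d})"
        show "zigzag c d N x = 0"
        proof (cases "x < 2 * d * N")
          case True
          define i where "i = nat \<lfloor>x / (2 * d)\<rfloor>"
          have "x > 0" using x I by auto
          then have i: "real i \<le> x / (2 * d)" "x / (2 * d) < real i + 1"
            using d by (auto simp: i_def)
          then have cell: "2 * real i * d \<le> x" "x < 2 * real i * d + 2 * d"
            using d by (auto simp: field_simps)
          have "real i * (2 * d) < real N * (2 * d)" using cell(1) True by (simp add: mult_ac)
          then have "i < N" using d by simp
          then have "x \<noteq> 2 * real i * d" using elim by force
          then have "x \<in> {(2 * real i + 1) * d - d<..<(2 * real i + 1) * d + d}"
            using cell by (auto simp: algebra_simps)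
          then have False using x \<open>i < N\<close> by (auto simp: zigzag_nodes_def)
          then show ?thesis ..
        qed (simp add: zigzag_zero)
      qed
    qed
    ultimately show ?thesis by (simp only: AE_lebesgue_on_iff)
  qed
  ultimately show ?thesis by (simp add: antisymmetric_step_def)
qed

text \<open>
  Around a point that is neither a jump nor the cut-off, the wave is constant; around the
  cut-off it takes one nonzero value at most.
\<close>

lemma zigzag_crossings_subset:
  assumes c: "c > 0" and d: "d > 0" and I: "I = {0<..<L}"
  shows "nodal_crossings I (zigzag c d N) \<subseteq> zigzag_nodes d N"
proof
  fix x assume "x \<in> nodal_crossings I (zigzag c d N)"
  then have x: "x \<in> I" "x \<in> closure (pos_set I (zigzag c d N))" "x \<in> closure (neg_set I (zigzag c d N))"
    unfolding nodal_crossings_def by (auto simp: frontier_of_top_of_set pos_set_def neg_set_def)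
  have meets: "\<exists>y\<in>S. zigzag c d N y > 0" "\<exists>y\<in>S. zigzag c d N y < 0" if "open S" "x \<in> S" for S
  proof -
    have "S \<inter> pos_set I (zigzag c d N) \<noteq> {}" "S \<inter> neg_set I (zigzag c d N) \<noteq> {}"
      using that x open_Int_closure_eq_empty[OF that(1)] by blast+
    then show "\<exists>y\<in>S. zigzag c d N y > 0" "\<exists>y\<in>S. zigzag c d N y < 0"
      by (auto simp: pos_set_def neg_set_def)
  qed
  show "x \<in> zigzag_nodes d N"
  proof (rule ccontr)
    assume out: "x \<notin> zigzag_nodes d N"
    have "x > 0" using x I by auto
    have "\<not> x > 2 * d * N"
      using meets(1)[of "{2 * d * N<..}"] zigzag_zero[of d N _ c] by fastforce
    then have le: "x \<le> 2 * d * N" by simp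
    define i where "i = nat \<lfloor>(x + d) / (2 * d)\<rfloor>"
    have "0 \<le> \<lfloor>(x + d) / (2 * d)\<rfloor>" using \<open>x > 0\<close> d by simp
    then have "real i = of_int \<lfloor>(x + d) / (2 * d)\<rfloor>" by (simp add: i_def)
    then have i: "real i \<le> (x + d) / (2 * d)" "(x + d) / (2 * d) < real i + 1" by linarith+
    then have cell: "(2 * real i - 1) * d \<le> x" "x < (2 * real i + 1) * d"
      using d by (auto simp: field_simps)
    have "x \<noteq> (2 * real i - 1) * d"
    proof
      assume eq: "x = (2 * real i - 1) * d"
      then have "(2 * real i - 1) > 0" using \<open>x > 0\<close> d by (simp add: zero_less_mult_iff)
      then obtain j where j: "i = Suc j" by (cases i) auto
      have "(2 * real j + 1) * d \<le> (2 * real N) * d" using le eq j by (simp add: algebra_simps)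
      then have "2 * real j + 1 \<le> 2 * real N" using d by simp
      then have "j < N" by linarith
      then show False using out eq j by (auto simp: zigzag_nodes_def)
    qed
    then have mem: "x \<in> {(2 * real i - 1) * d<..<(2 * real i + 1) * d}" using cell by auto
    have "zigzag c d N y = (if even i then c else - c) \<or> zigzag c d N y = 0"
      if "y \<in> {(2 * real i - 1) * d<..<(2 * real i + 1) * d}" for y
      using zigzag_on_cell[OF d, of i y N c] that zigzag_zero[of d N y c] by (cases "y < 2 * d * N") auto
    then show False using meets[OF _ mem] c by (cases "even i") force+
  qed
qed

text \<open>
  The closure of a zero component can meet the two frontiers only at the cut-off \<open>2 * d * N\<close>, and
  only one sign occurs near that point.
\<close>

lemma zigzag_effective_nodal_set:
  assumes c: "c > 0" and d: "d > 0" and I: "I = {0<..<L}"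
  shows "effective_nodal_set I (zigzag c d N) (nodal_crossings I (zigzag c d N))"
proof -
  let ?g = "zigzag c d N"
  have "effective_zero_components I ?g = {}"
  proof (rule ccontr)
    assume "effective_zero_components I ?g \<noteq> {}"
    then obtain J a b where J: "J \<in> zero_components I ?g"
      and a: "a \<in> top_of_set I closure_of J" "a \<in> top_of_set I frontier_of pos_set I ?g"
      and b: "b \<in> top_of_set I closure_of J" "b \<in> top_of_set I frontier_of neg_set I ?g"
      unfolding effective_zero_components_def by blast
    have J_sub: "J \<subseteq> {x \<in> I. ?g x = 0}"
      using J in_components_subset unfolding zero_components_def by blast
    then have "J \<subseteq> {2 * d * N..}" using c by (auto simp: zigzag_def split: if_splits)
    then have J_cl: "closure J \<subseteq> {2 * d * N..}" by (intro closure_minimal) auto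
    have signs: "closure (pos_set I ?g) \<subseteq> {..2 * d * N}" "closure (neg_set I ?g) \<subseteq> {..2 * d * N}"
    proof -
      have "pos_set I ?g \<subseteq> {..2 * d * N}" "neg_set I ?g \<subseteq> {..2 * d * N}"
        using c by (auto simp: zigzag_def pos_set_def neg_set_def split: if_splits)
      then show "closure (pos_set I ?g) \<subseteq> {..2 * d * N}" "closure (neg_set I ?g) \<subseteq> {..2 * d * N}"
        by (simp_all add: closure_minimal)
    qed
    have "J \<subseteq> I" using J_sub by blast
    have "a \<in> closure J" "b \<in> closure J"
      using a(1) b(1) \<open>J \<subseteq> I\<close> by (auto simp: closure_of_top_of_set)
    moreover have "a \<in> closure (pos_set I ?g)" "b \<in> closure (neg_set I ?g)"
      using a(2) b(2) by (auto simp: frontier_of_top_of_set pos_set_def neg_set_def)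
    ultimately have "a = 2 * d * N" "b = 2 * d * N"
      using J_cl signs by (force intro: antisym)+
    then have "2 * d * N \<in> nodal_crossings I ?g"
      using a(2) b(2) by (simp add: nodal_crossings_def)
    then have mem: "2 * d * N \<in> zigzag_nodes d N" using zigzag_crossings_subset[OF c d I] by blast
    have "2 * d * N \<in> {2 * d * N - d<..<2 * d * N + d}" using d by auto
    then have "2 * d * N \<in> {0<..<2 * d * N}" using zigzag_ball_subset[OF d mem] by blast
    then show False by simp
  qed
  then show ?thesis
    unfolding effective_nodal_set_def nodal_representatives_def by (intro exI[of _ "{}"]) auto
qed

lemma integral_antisymmetric_step:
  assumes step: "antisymmetric_step I Z c d f" and I: "I \<in> sets lebesgue"
    and f: "f \<in> borel_measurable (lebesgue_on I)"
    and Z: "finite Z" and c: "c > 0" and d: "d > 0"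
    and inside: "\<And>z. z \<in> Z \<Longrightarrow> {z - d<..<z + d} \<subseteq> I"
    and disjoint: "\<And>z z'. z \<in> Z \<Longrightarrow> z' \<in> Z \<Longrightarrow> z \<noteq> z' \<Longrightarrow> {z - d<..<z + d} \<inter> {z' - d<..<z' + d} = {}"
  shows "(\<integral>x. f x \<partial>lebesgue_on I) = 0"
proof -
  obtain u v where uv: "\<And>z. z \<in> Z \<Longrightarrow> (u z, v z) \<in> {(z - d, z), (z, z - d)}"
    and parts: "AE x in lebesgue_on I. f_plus f x = c * (\<Sum>z\<in>Z. indicator {u z<..<u z + d} x)
           \<and> f_minus f x = - (c * (\<Sum>z\<in>Z. indicator {v z<..<v z + d} x))"
    using antisymmetric_step_parts[OF step I Z c d disjoint] by blast
  have half: "has_bochner_integral (lebesgue_on I) (indicator {w<..<w + d}) d"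
    if "z \<in> Z" "w = z - d \<or> w = z" for w z
  proof -
    have "{w<..<w + d} \<subseteq> {z - d<..<z + d}" using that(2) d by auto
    then have sub: "{w<..<w + d} \<subseteq> I" using inside[OF that(1)] by blast
    have "emeasure (lebesgue_on I) {w<..<w + d} = ennreal d"
      using I sub d by (subst emeasure_restrict_space) auto
    moreover have "{w<..<w + d} \<in> sets (lebesgue_on I)" using I sub by (simp add: sets_restrict_space_iff)
    ultimately show ?thesis
      using has_bochner_integral_real_indicator[of "{w<..<w + d}" "lebesgue_on I"] d by (simp add: measure_def)
  qed
  have "has_bochner_integral (lebesgue_on I)
      (\<lambda>x. c * (\<Sum>z\<in>Z. indicator {u z<..<u z + d} x) - c * (\<Sum>z\<in>Z. indicator {v z<..<v z + d} x))
      (c * (\<Sum>z\<in>Z. d) - c * (\<Sum>z\<in>Z. d))"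
    using uv by (intro has_bochner_integral_diff has_bochner_integral_mult_right has_bochner_integral_sum half) auto
  then have int: "has_bochner_integral (lebesgue_on I)
      (\<lambda>x. c * (\<Sum>z\<in>Z. indicator {u z<..<u z + d} x) - c * (\<Sum>z\<in>Z. indicator {v z<..<v z + d} x)) 0"
    by simp
  have "AE x in lebesgue_on I. f x =
    c * (\<Sum>z\<in>Z. indicator {u z<..<u z + d} x) - c * (\<Sum>z\<in>Z. indicator {v z<..<v z + d} x)"
    using parts
  proof eventually_elim
    case (elim x)
    have "f x = f_plus f x + f_minus f x" by (simp add: f_plus_def f_minus_def)
    then show ?case using elim by simp
  qed
  then have "(\<integral>x. f x \<partial>lebesgue_on I) = (\<integral>x. c * (\<Sum>z\<in>Z. indicator {u z<..<u z + d} x)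
      - c * (\<Sum>z\<in>Z. indicator {v z<..<v z + d} x) \<partial>lebesgue_on I)"
    using f int by (intro integral_cong_AE) (auto dest: borel_measurable_has_bochner_integral)
  then show ?thesis using int by (simp add: has_bochner_integral_iff)
qed

lemma balanced_zigzag:
  assumes c: "c > 0" and d: "d > 0" and I: "I = {0<..<L}" and L: "2 * d * N \<le> L" and N: "N > 0"
  shows "balanced_function I (zigzag c d N)"
    and "Linf_norm I (zigzag c d N) = c" and "L1_norm I (zigzag c d N) = 2 * d * N * c"
proof -
  let ?g = "zigzag c d N" and ?S = "{0<..<2 * d * N}"
  have I_leb: "I \<in> sets lebesgue" using I by simp
  have "0 < 2 * d * real N" using d N by simp
  then have S: "?S \<subseteq> I" "?S \<noteq> {}" "open ?S"
    using I L by (auto simp only: greaterThanLessThan_empty_iff open_greaterThanLessThan greaterThanLessThan_subseteq_greaterThanLessThan)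
  have enorm: "Linf_enorm I ?g = ereal c"
    using S c by (intro Linf_enorm_eqI[OF I_leb zigzag_measurable _ S(3,2,1)]) (auto simp: abs_zigzag)
  then show "Linf_norm I ?g = c" by (simp add: Linf_norm_def)
  have "L1_norm I ?g = (\<integral>x. c * indicator ?S x \<partial>lebesgue_on I)"
    unfolding L1_norm_def using c I
    by (intro Bochner_Integration.integral_cong) (auto simp: abs_zigzag indicator_def)
  also have "\<dots> = c * measure (lebesgue_on I) ?S"
  proof -
    have "?S \<inter> I = ?S" using S(1) by blast
    then show ?thesis by simp
  qed
  also have "measure (lebesgue_on I) ?S = 2 * d * N"
    using S(1) I_leb d by (subst measure_restrict_space) auto
  finally show L1: "L1_norm I ?g = 2 * d * N * c" by simp
  show "balanced_function I ?g"
  proof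
    show "open I" "bounded I" "is_interval I" using I by (auto simp: is_interval_oo)
    show "mem_Linf I ?g" using enorm zigzag_measurable by (simp add: mem_Linf_def)
    show "\<not> (AE x in lebesgue_on I. ?g x = 0)"
    proof
      assume "AE x in lebesgue_on I. ?g x = 0"
      then have "L1_norm I ?g = 0" unfolding L1_norm_def by (intro integral_eq_zero_AE) auto
      then show False using L1 c d N by simp
    qed
    have inside: "{z - d<..<z + d} \<subseteq> I" if "z \<in> zigzag_nodes d N" for z
      using zigzag_ball_subset[OF d that] S(1) by blast
    show "(\<integral>x. ?g x \<partial>lebesgue_on I) = 0"
      by (rule integral_antisymmetric_step[OF zigzag_antisymmetric_step[OF c d I L] I_leb
          zigzag_measurable _ c d inside zigzag_balls_disjoint[OF d]])
         (auto simp: zigzag_nodes_def)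
  qed
qed

section \<open>The sharp inequality\<close>

theorem corollary6:
  fixes L p :: real and I Z :: "real set" and f :: "real \<Rightarrow> real"
  assumes "L > 0" and "I = {0<..<L}" and "p \<ge> 1"
    and "mem_Linf I f"
    and "\<not> (AE x in lebesgue_on I. f x = 0)"
    and "(\<integral>x. f x \<partial>lebesgue_on I) = 0"
    and "effective_nodal_set I f Z" and "finite Z"
  shows "let c_inf = Linf_norm I f; c_1 = L1_norm I f; N = card Z;
             X = admissible c_inf c_1 N I;
             bound = 2 powr (- 1 - 1 / p) * (c_1 / c_inf) * c_1 powr (1 / p)
         in W_parts p I f * real N \<ge> bound
          \<and> (\<exists>g\<in>X. W_parts p I g * real N = bound)
          \<and> (W_parts p I f * real N = bound \<longleftrightarrow> is_arg_min (W_parts p I) (\<lambda>h. h \<in> X) f)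
          \<and> (W_parts p I f * real N = bound \<longleftrightarrow>
               antisymmetric_step I Z c_inf (c_1 / (2 * c_inf * real N)) f)"
proof -
  have interval: "is_interval I" using assms(2) by (simp add: is_interval_oo)
  interpret f: balanced_function I f
    by unfold_locales (use assms interval in auto)
  define c c1 N X where "c = Linf_norm I f" and "c1 = L1_norm I f" and "N = card Z"
    and "X = admissible c c1 N I"
  define bound where "bound = 2 powr (- 1 - 1 / p) * (c1 / c) * c1 powr (1 / p)"
  define d where "d = c1 / (2 * c * real N)"
  \<comment> \<open>The bound divided by \<open>N\<close>: the mass \<open>c1 / 2\<close> moved by the distance \<open>d\<close>.\<close>
  define low where "low = d * (c1 / 2) powr (1 / p)"
  have c: "c > 0" and c1: "c1 > 0" using f.height_pos f.mass_pos by (simp_all add: c_def c1_def)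
  note sep = effective_nodal_set_separates[OF interval assms(7)]
  have N: "N > 0"
    using f.separating_set_nonempty[OF sep] assms(8) by (simp add: N_def card_gt_0_iff)
  have d: "d > 0" using c c1 N by (simp add: d_def)
  have bound: "bound = low * real N"
    using c c1 N by (simp add: bound_def low_def d_def powr_diff powr_minus powr_divide field_simps)
  have equal_iff: "w * real N = bound \<longleftrightarrow> w = low" for w using N by (simp add: bound)
  have low_le: "low \<le> W_parts p I h" if h: "h \<in> X" for h
  proof -
    from h obtain Zh where h': "mem_Linf I h" "Linf_norm I h = c" "L1_norm I h = c1"
      "(\<integral>x. h x \<partial>lebesgue_on I) = 0" "effective_nodal_set I h Zh" "finite Zh" "card Zh = N"
      unfolding X_def admissible_def by blast
    have "\<not> (AE x in lebesgue_on I. h x = 0)"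
    proof
      assume "AE x in lebesgue_on I. h x = 0"
      then have "L1_norm I h = 0" unfolding L1_norm_def by (intro integral_eq_zero_AE) auto
      then show False using h'(3) c1 by simp
    qed
    then interpret h: balanced_function I h
      by unfold_locales (use h' interval assms(2) in auto)
    show ?thesis
      using h.W_parts_ge_width[OF effective_nodal_set_separates[OF interval h'(5)] h'(6) assms(3)] h'
      by (simp add: low_def d_def)
  qed
  have f_X: "f \<in> X"
    unfolding X_def admissible_def using assms by (auto simp: c_def c1_def N_def)
  have fits: "2 * d * real N \<le> L"
  proof -
    have "c1 \<le> (\<integral>x. c \<partial>lebesgue_on I)"
      unfolding c1_def L1_norm_def c_def using f.AE_le_height f.f_integrable
      by (intro integral_mono_AE integrable_abs finite_measure.integrable_const f.finite_I) auto
    also have "\<dots> = c * L" using assms(1,2) by (simp add: measure_restrict_space)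
    finally show ?thesis using c N by (simp add: d_def field_simps)
  qed
  define g where "g = zigzag c d N"
  note g_norms = balanced_zigzag(2,3)[OF c d assms(2) fits N, folded g_def]
  interpret g: balanced_function I g
    unfolding g_def by (rule balanced_zigzag(1)[OF c d assms(2) fits N])
  have g_L1: "L1_norm I g = c1" using g_norms(2) c N by (simp add: d_def)
  have fin_nodes: "finite (zigzag_nodes d N)" by (simp add: zigzag_nodes_def)
  have g_low: "W_parts p I g \<le> low"
  proof -
    have step: "antisymmetric_step I (zigzag_nodes d N) g.height (g.width (card (zigzag_nodes d N))) g"
      using zigzag_antisymmetric_step[OF c d assms(2) fits]
      by (simp add: g_norms(1) g_L1 card_zigzag_nodes[OF d] g_def[symmetric] d_def[symmetric])
    have "W_parts p I g \<le> (g.mass * d powr p) powr (1 / p)"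
      using g.W_parts_antisymmetric_step[OF step fin_nodes, of p] N
      by (simp add: g_norms(1) g_L1 card_zigzag_nodes[OF d] d_def[symmetric])
    then show ?thesis using g.cost_root[OF d assms(3)] by (simp add: low_def g_L1)
  qed
  \<comment> \<open>The wave has at most \<open>N\<close> nodal points by construction. It has no fewer, because its cost is
    at most the bound for \<open>N\<close> points, which is smaller than the bound for fewer points.\<close>
  have g_X: "g \<in> X"
  proof -
    let ?Z = "nodal_crossings I g"
    have Z: "effective_nodal_set I g ?Z" "?Z \<subseteq> zigzag_nodes d N"
      using zigzag_effective_nodal_set[OF c d assms(2)] zigzag_crossings_subset[OF c d assms(2)]
      by (simp_all add: g_def)
    have fin: "finite ?Z" using Z(2) fin_nodes by (rule finite_subset)
    note sep_g = effective_nodal_set_separates[OF interval Z(1)]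
    have pos: "card ?Z > 0" using g.separating_set_nonempty[OF sep_g] fin by (simp add: card_gt_0_iff)
    have "card ?Z \<le> N"
      using card_mono[OF fin_nodes Z(2)] card_zigzag_nodes[OF d] by simp
    moreover have "\<not> card ?Z < N"
    proof
      assume less: "card ?Z < N"
      have "d < g.width (card ?Z)"
        unfolding d_def g_norms(1) g_L1 using less pos c c1 by (intro divide_strict_left_mono) auto
      then have "low < g.width (card ?Z) * g.mass powr (1 / p)"
        unfolding low_def g_L1 using c1 by (intro mult_strict_right_mono) auto
      also have "\<dots> \<le> W_parts p I g" by (rule g.W_parts_ge_width[OF sep_g fin assms(3)])
      finally show False using g_low by simp
    qed
    ultimately have "card ?Z = N" by simp
    then show ?thesis
      unfolding X_def admissible_def
      using Z(1) fin g_norms(1) g_L1 g.bounded_f g.mean_zero by blast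
  qed
  have g_eq: "W_parts p I g = low" using g_low low_le[OF g_X] by simp
  have "bound \<le> W_parts p I f * real N"
    unfolding bound using low_le[OF f_X] by (intro mult_right_mono) auto
  moreover have "\<exists>g\<in>X. W_parts p I g * real N = bound" using g_X g_eq bound by auto
  moreover have "W_parts p I f * real N = bound \<longleftrightarrow> is_arg_min (W_parts p I) (\<lambda>h. h \<in> X) f"
    unfolding equal_iff is_arg_min_def using low_le f_X g_X g_eq by (auto simp: not_less intro: antisym)
  moreover have "W_parts p I f * real N = bound \<longleftrightarrow> antisymmetric_step I Z c d f"
  proof
    assume "W_parts p I f * real N = bound"
    then have "W_parts p I f = low" by (simp only: equal_iff)
    then show "antisymmetric_step I Z c d f"
      using f.antisymmetric_step_of_equality[OF sep assms(8,3)]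
      by (simp add: low_def d_def c_def c1_def N_def)
  next
    assume "antisymmetric_step I Z c d f"
    then have "W_parts p I f \<le> (f.mass * d powr p) powr (1 / p)"
      using f.W_parts_antisymmetric_step[of Z p] assms(8) N
      by (simp add: d_def c_def c1_def N_def)
    then have "W_parts p I f \<le> low"
      using f.cost_root[OF d assms(3)] by (simp add: low_def c1_def)
    then show "W_parts p I f * real N = bound" using low_le[OF f_X] by (simp add: equal_iff)
  qed
  ultimately show ?thesis
    unfolding Let_def d_def bound_def X_def N_def c_def c1_def by blast
qed

end
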